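(* Let $d\ge2$ and assume that $\mathbf M=(M_n)_{n\in\mathbb Z}\in\mathcal M_d^{\mathbb Z}$ is two-sided primitive and satisfies the two-sided local Pisot condition and the two-sided growth condition $\lim_{n\to\pm\infty}\frac1n\log\lVert M_n\rVert=0$. Then $\mathbf M$ admits strong convergence to a generalized right eigenvector $\mathbf u$ in the future and to a generalized left eigenvector $\mathbf v$ in the past. The mapping family $(\mathbb T,f_{\mathbf M})$ associated to $\mathbf M$ is eventually Anosov for the splitting $$G^s\oplus G^u=\coprod_{n\in\mathbb Z}G^s_n\oplus G^u_n=\coprod_{n\in\mathbb Z}\mathbb R\mathbf u_n\oplus\mathbf v_n^\perp .$$
   Context: $\mathcal M_d$ is the set of $d\times d$ matrices with nonnegative integer entries and determinant $\pm1$; $M^\top$ is the transpose; $\lVert\cdot\rVert$ is any norm; $M_{[m,n)}=M_m\cdots M_{n-1}$ for $m\le n$ (identity if $m=n$); $\mathbf e_i$ are the standard basis vectors; $\mathbf v^\perp$ is the hyperplane orthogonal to $\mathbf v$; $\mathrm d$ is Euclidean distance. Two-sided primitive: for each $m\in\mathbb Z$ there is $n>m$ such that all entries of $M_{[m,n)}$ are positive, and for each $n\in\mathbb Z$ there is $m<n$ such that all entries of $M_{[m,n)}$ are positive. Two-sided local Pisot condition: $\limsup_{n\to\infty}\frac1n\log\delta_2(M_{[0,n)})<0$ and the same holds for the sequence $(M^{\top}_{-n-1})_{n\in\mathbb Z}$ in place of $\mathbf M$; here $\delta_2$ is the second largest singular value (with multiplicity). Generalized right eigenvector: $\mathbf u\in\mathbb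 R^d_{\ge0}\setminus\{\mathbf 0\}$ with $\bigcap_{n\in\mathbb N}M_{[0,n)}\mathbb R_{\ge0}^d=\mathbb R_{\ge0}\mathbf u$. Generalized left eigenvector: $\mathbf v\in\mathbb R^d_{\ge0}\setminus\{\mathbf 0\}$ with $\bigcap_{n\in\mathbb N}M_{[-n,0)}^\top\mathbb R_{\ge0}^d=\mathbb R_{\ge0}\mathbf v$. Put $\mathbf u_n=M_{[0,n)}^{-1}\mathbf u$, $\mathbf v_n=M_{[0,n)}^\top\mathbf v$ for $n\ge0$, and $\mathbf u_n=M_{[n,0)}\mathbf u$, $\mathbf v_n=(M_{[n,0)}^\top)^{-1}\mathbf v$ for $n<0$. Strong convergence to $\mathbf u$ in the future: $\lim_{n\to\infty}\mathrm d(M_{[0,n)}\mathbf e_i,\mathbb R\mathbf u)=0$ for all $i$. Strong convergence to $\mathbf v$ in the past: $\lim_{n\to\infty}\mathrm d(M_{[-n,0)}^\top\mathbf e_i,\mathbb R\mathbf v)=0$ for all $i$. Mapping family: for each $n\in\mathbb Z$ let $\mathbb T_n$ be a copy of $\mathbb R^d/\mathbb Z^d$, $\mathbb T=\coprod_n\mathbb T_n$, and $f_{\mathbf M}:\mathbb T\to\mathbb T$, $f_{\mathbf M}(\mathbf x)=M_n^{-1}\mathbf x\in\mathbb T_{n+1}$ for $\mathbf x\in\mathbb T_n$. All tangent spaces at points of $\mathbb T_n$ are identified with $\mathbb R^d$. $(\mathbb T,f_{\mathbf M})$ is eventually Anosov for a splitting $\coprod_n G_n^s\oplus G_n^u$ (with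 $\mathbb R^d=G_n^s\oplus G_n^u$, $M_n^{-1}G_n^s=G_{n+1}^s$, $M_n^{-1}G_n^u=G_{n+1}^u$) if for each $n\in\mathbb Z$: (i) $\lim_{k\to+\infty}\sup\{\lVert M_{[n,k)}^{-1}\mathbf x\rVert/\lVert\mathbf x\rVert:\mathbf x\in G_n^s\setminus\{\mathbf 0\}\}=0$; (ii) $\lim_{k\to+\infty}\inf\{\lVert M_{[n,k)}^{-1}\mathbf x\rVert/\lVert\mathbf x\rVert:\mathbf x\in G_n^u\setminus\{\mathbf 0\}\}=+\infty$; (iii) $\lim_{k\to-\infty}\inf\{\lVert M_{[k,n)}\mathbf x\rVert/\lVert\mathbf x\rVert:\mathbf x\in G_n^s\setminus\{\mathbf 0\}\}=+\infty$; (iv) $\lim_{k\to-\infty}\sup\{\lVert M_{[k,n)}\mathbf x\rVert/\lVert\mathbf x\rVert:\mathbf x\in G_n^u\setminus\{\mathbf 0\}\}=0$. *)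

theory Defs
  imports "HOL-Analysis.Analysis"
begin

section \<open>Bi-infinite sequences of unimodular matrices\<close>

definition nonneg_unimodular :: "(real^'d^'d) set" where
  "nonneg_unimodular = {A. (\<forall>i j. A $ i $ j \<in> \<nat>) \<and> (det A = 1 \<or> det A = -1)}"

text \<open>The product \<open>M m ** \<dots> ** M (n - 1)\<close>, which is the identity matrix if \<open>n \<le> m\<close>.\<close>

definition mprod :: "(int \<Rightarrow> real^'d^'d) \<Rightarrow> int \<Rightarrow> int \<Rightarrow> real^'d^'d" where
  "mprod M m n = foldr (\<lambda>k A. M k ** A) [m..n - 1] (mat 1)"

definition two_sided_primitive :: "(int \<Rightarrow> real^'d^'d) \<Rightarrow> bool" where
  "two_sided_primitive M \<longleftrightarrow>
     (\<forall>m. \<exists>n>m. \<forall>i j. mprod M m n $ i $ j > 0) \<and>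
     (\<forall>n. \<exists>m<n. \<forall>i j. mprod M m n $ i $ j > 0)"

text \<open>A norm on a real vector space, in general different from the type class operation \<^const>\<open>norm\<close>;
  nonnegativity follows from the three axioms.\<close>

definition is_norm :: "('a::real_vector \<Rightarrow> real) \<Rightarrow> bool" where
  "is_norm N \<longleftrightarrow>
     (\<forall>x. N x = 0 \<longleftrightarrow> x = 0) \<and> (\<forall>c x. N (c *\<^sub>R x) = \<bar>c\<bar> * N x) \<and> (\<forall>x y. N (x + y) \<le> N x + N y)"

definition growth_condition :: "(real^'d^'d \<Rightarrow> real) \<Rightarrow> (int \<Rightarrow> real^'d^'d) \<Rightarrow> bool" where
  "growth_condition N M \<longleftrightarrow>
     ((\<lambda>n. 1 / real_of_int n * ln (N (M n))) \<longlongrightarrow> 0) at_top \<and>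
     ((\<lambda>n. 1 / real_of_int n * ln (N (M n))) \<longlongrightarrow> 0) at_bot"

section \<open>Singular values and the Pisot condition\<close>

definition charpoly :: "real^'d^'d \<Rightarrow> real poly" where
  "charpoly A = det (\<chi> i j. (if i = j then [:0, 1:] else 0) - [:A $ i $ j:])"

text \<open>The square roots of the eigenvalues of \<open>A\<^sup>T A\<close>, each one repeated according to its
  multiplicity. Since \<open>A\<^sup>T A\<close> is symmetric positive semidefinite, there are \<open>CARD('d)\<close> of them.\<close>

definition singular_values :: "real^'d^'d \<Rightarrow> real multiset" where
  "singular_values A = image_mset sqrt (proots (charpoly (transpose A ** A)))"

definition delta2 :: "real^'d^'d \<Rightarrow> real" where
  "delta2 A = rev (sorted_list_of_multiset (singular_values A)) ! 1"

definition local_pisot :: "(int \<Rightarrow> real^'d^'d) \<Rightarrow> bool" where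
  "local_pisot M \<longleftrightarrow> limsup (\<lambda>n::nat. ereal (1 / real n * ln (delta2 (mprod M 0 (int n))))) < 0"

definition two_sided_local_pisot :: "(int \<Rightarrow> real^'d^'d) \<Rightarrow> bool" where
  "two_sided_local_pisot M \<longleftrightarrow> local_pisot M \<and> local_pisot (\<lambda>n. transpose (M (- n - 1)))"

section \<open>Generalized eigenvectors and strong convergence\<close>

definition nonneg_orthant :: "(real^'d) set" where
  "nonneg_orthant = {x. \<forall>i. x $ i \<ge> 0}"

definition generalized_right_eigenvector :: "(int \<Rightarrow> real^'d^'d) \<Rightarrow> real^'d \<Rightarrow> bool" where
  "generalized_right_eigenvector M u \<longleftrightarrow>
     u \<in> nonneg_orthant - {0} \<and>
     (\<Inter>n::nat. (*v) (mprod M 0 (int n)) ` nonneg_orthant) = {t *\<^sub>R u | t. t \<ge> 0}"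

definition generalized_left_eigenvector :: "(int \<Rightarrow> real^'d^'d) \<Rightarrow> real^'d \<Rightarrow> bool" where
  "generalized_left_eigenvector M v \<longleftrightarrow>
     v \<in> nonneg_orthant - {0} \<and>
     (\<Inter>n::nat. (*v) (transpose (mprod M (- int n) 0)) ` nonneg_orthant) = {t *\<^sub>R v | t. t \<ge> 0}"

definition right_vec :: "(int \<Rightarrow> real^'d^'d) \<Rightarrow> real^'d \<Rightarrow> int \<Rightarrow> real^'d" where
  "right_vec M u n =
     (if n \<ge> 0 then matrix_inv (mprod M 0 n) *v u else mprod M n 0 *v u)"

definition left_vec :: "(int \<Rightarrow> real^'d^'d) \<Rightarrow> real^'d \<Rightarrow> int \<Rightarrow> real^'d" where
  "left_vec M v n =
     (if n \<ge> 0 then transpose (mprod M 0 n) *v v else matrix_inv (transpose (mprod M n 0)) *v v)"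

text \<open>The distance to the line through a vector is \<^const>\<open>infdist\<close> to its \<^const>\<open>span\<close>.\<close>

definition strong_convergence_future :: "(int \<Rightarrow> real^'d^'d) \<Rightarrow> real^'d \<Rightarrow> bool" where
  "strong_convergence_future M u \<longleftrightarrow>
     (\<forall>i. (\<lambda>n::nat. infdist (mprod M 0 (int n) *v axis i 1) (span {u})) \<longlonglongrightarrow> 0)"

definition strong_convergence_past :: "(int \<Rightarrow> real^'d^'d) \<Rightarrow> real^'d \<Rightarrow> bool" where
  "strong_convergence_past M v \<longleftrightarrow>
     (\<forall>i. (\<lambda>n::nat. infdist (transpose (mprod M (- int n) 0) *v axis i 1) (span {v})) \<longlonglongrightarrow> 0)"

section \<open>Mapping families on tori\<close>

definition lattice_equiv :: "real^'d \<Rightarrow> real^'d \<Rightarrow> bool" where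
  "lattice_equiv x y \<longleftrightarrow> (\<forall>i. x $ i - y $ i \<in> \<int>)"

quotient_type 'd torus = "real^'d::finite" / lattice_equiv
  morphisms rep_torus proj_torus
proof (rule equivpI)
  show "reflp lattice_equiv" by (simp add: reflp_def lattice_equiv_def)
  show "symp lattice_equiv"
    unfolding symp_def lattice_equiv_def by (metis Ints_minus minus_diff_eq)
  show "transp lattice_equiv"
    unfolding transp_def lattice_equiv_def by (smt (verit) Ints_add)
qed

text \<open>The disjoint union of the tori \<open>T\<^sub>n\<close> is the type \<^typ>\<open>int \<times> 'd torus\<close>: the pair \<open>(n, p)\<close> is
  the point \<open>p\<close> of \<open>T\<^sub>n\<close>. The choice of the representative is immaterial for unimodular
  matrices, see \<open>mapping_family_lifts\<close> below.\<close>

definition mapping_family :: "(int \<Rightarrow> real^'d^'d) \<Rightarrow> int \<times> 'd torus \<Rightarrow> int \<times> 'd torus" where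
  "mapping_family M = (\<lambda>(n, p). (n + 1, proj_torus (matrix_inv (M n) *v rep_torus p)))"

text \<open>\<open>f\<close> is induced on each \<open>T\<^sub>n\<close> by the linear map \<open>matrix_inv (M n)\<close>, which is thus the
  differential of \<open>f\<close> at every point of \<open>T\<^sub>n\<close>, all tangent spaces being identified with
  \<^typ>\<open>real^'d\<close>.\<close>

definition induced_by :: "(int \<times> 'd torus \<Rightarrow> int \<times> 'd torus) \<Rightarrow> (int \<Rightarrow> real^'d^'d) \<Rightarrow> bool" where
  "induced_by f M \<longleftrightarrow>
     (\<forall>n. invertible (M n)) \<and>
     (\<forall>n x. f (n, proj_torus x) = (n + 1, proj_torus (matrix_inv (M n) *v x)))"

lemma matrix_inv_mult:
  fixes A :: "real^'d^'d"
  assumes "invertible A"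
  shows "A ** matrix_inv A = mat 1" "matrix_inv A ** A = mat 1"
  using someI_ex[OF assms[unfolded invertible_def]] by (auto simp: matrix_inv_def)

lemma mapping_family_lifts:
  assumes M: "\<And>n. M n \<in> nonneg_unimodular"
  shows "induced_by (mapping_family M) M"
proof -
  have inv: "invertible (M n)" for n
    using M[of n] by (auto simp: nonneg_unimodular_def invertible_det_nz)
  have int: "(matrix_inv (M n) *v z) $ i \<in> \<int>" if z: "\<And>i. z $ i \<in> \<int>" for n z i
  proof -
    define A where "A = M n"
    have A: "A $ i $ j \<in> \<int>" for i j
      using M[of n] Nats_subset_Ints by (auto simp: A_def nonneg_unimodular_def)
    have d: "det A = 1 \<or> det A = -1"
      using M[of n] by (auto simp: A_def nonneg_unimodular_def)
    have "A *v (matrix_inv A *v z) = z"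
      using inv[of n] by (simp add: A_def matrix_vector_mul_assoc matrix_inv_mult)
    then have *: "matrix_inv A *v z =
        (\<chi> k. det (\<chi> i j. if j = k then z $ i else A $ i $ j) / det A)"
      using cramer[of A "matrix_inv A *v z" z] d by auto
    have "det (\<chi> r j. if j = i then z $ r else A $ r $ j) \<in> \<int>"
      unfolding det_def using A z by (auto intro!: Ints_sum Ints_mult Ints_prod)
    then have "det (\<chi> r j. if j = i then z $ r else A $ r $ j) / det A \<in> \<int>"
      using d by auto
    then show ?thesis using * by (simp add: A_def)
  qed
  have "proj_torus (matrix_inv (M n) *v rep_torus (proj_torus x)) = proj_torus (matrix_inv (M n) *v x)"
    for n x
  proof -
    have "lattice_equiv (rep_torus (proj_torus x)) x"
      by (metis Quotient3_rel_rep Quotient3_torus torus.abs_eq_iff Quotient3_abs_rep)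
    then have "\<And>i. (rep_torus (proj_torus x) - x) $ i \<in> \<int>"
      by (simp add: lattice_equiv_def)
    from int[OF this, of n] show ?thesis
      by (simp add: torus.abs_eq_iff lattice_equiv_def matrix_vector_mult_diff_distrib)
  qed
  then show ?thesis using inv by (simp add: induced_by_def mapping_family_def)
qed

lemma induced_by_unique:
  assumes "induced_by f A" "induced_by f B"
  shows "A = B"
proof
  fix n
  define C where "C = matrix_inv (A n) - matrix_inv (B n)"
  have invs: "invertible (A n)" "invertible (B n)"
    using assms by (auto simp: induced_by_def)
  have Z: "(C *v x) $ i \<in> \<int>" for x i
  proof -
    have "proj_torus (matrix_inv (A n) *v x) = proj_torus (matrix_inv (B n) *v x)"
      using assms unfolding induced_by_def by (metis prod.inject)
    then show ?thesis
      by (simp add: C_def torus.abs_eq_iff lattice_equiv_def matrix_vector_mult_diff_rdistrib)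
  qed
  have "C *v x = 0" for x
  proof (rule ccontr)
    assume "C *v x \<noteq> 0"
    then obtain i where i: "(C *v x) $ i \<noteq> 0" by (auto simp: vec_eq_iff)
    have "(C *v ((1 / (2 * (C *v x) $ i)) *\<^sub>R x)) $ i = 1 / 2"
      using i by (simp add: matrix_vector_mult_scaleR)
    then have "(1 / 2 :: real) \<in> \<int>" using Z by metis
    then obtain k :: int where "1 / 2 = real_of_int k" by (auto elim: Ints_cases)
    then have "1 = 2 * k" by linarith
    then show False by presburger
  qed
  then have "C = 0" by (simp add: matrix_eq)
  then have "matrix_inv (A n) = matrix_inv (B n)" by (simp add: C_def)
  then show "A n = B n"
    using invs by (metis matrix_inv_mult matrix_mul_assoc matrix_mul_lid matrix_mul_rid)
qed

definition invariant_splitting ::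
    "(int \<Rightarrow> real^'d^'d) \<Rightarrow> (int \<Rightarrow> (real^'d) set) \<Rightarrow> (int \<Rightarrow> (real^'d) set) \<Rightarrow> bool" where
  "invariant_splitting M Gs Gu \<longleftrightarrow>
     (\<forall>n. subspace (Gs n) \<and> subspace (Gu n) \<and>
          Gs n \<inter> Gu n = {0} \<and> {x + y | x y. x \<in> Gs n \<and> y \<in> Gu n} = UNIV \<and>
          (*v) (matrix_inv (M n)) ` Gs n = Gs (n + 1) \<and>
          (*v) (matrix_inv (M n)) ` Gu n = Gu (n + 1))"

text \<open>By \<open>induced_by_unique\<close> the matrices \<open>M n\<close> are determined by \<open>f\<close>. Suprema and infima are taken
  in the extended nonnegative reals, so that they are \<open>0\<close> and \<open>\<infinity>\<close> on a trivial subspace.\<close>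

definition eventually_anosov ::
    "(real^'d \<Rightarrow> real) \<Rightarrow> (int \<times> 'd torus \<Rightarrow> int \<times> 'd torus) \<Rightarrow>
     (int \<Rightarrow> (real^'d) set) \<Rightarrow> (int \<Rightarrow> (real^'d) set) \<Rightarrow> bool" where
  "eventually_anosov N f Gs Gu \<longleftrightarrow>
     (\<exists>M. induced_by f M \<and> invariant_splitting M Gs Gu \<and>
       (\<forall>n.
         ((\<lambda>k. SUP x \<in> Gs n - {0}. ennreal (N (matrix_inv (mprod M n k) *v x) / N x)) \<longlongrightarrow> 0) at_top \<and>
         ((\<lambda>k. INF x \<in> Gu n - {0}. ennreal (N (matrix_inv (mprod M n k) *v x) / N x)) \<longlongrightarrow> \<infinity>) at_top \<and>
         ((\<lambda>k. INF x \<in> Gs n - {0}. ennreal (N (mprod M k n *v x) / N x)) \<longlongrightarrow> \<infinity>) at_bot \<and>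
         ((\<lambda>k. SUP x \<in> Gu n - {0}. ennreal (N (mprod M k n *v x) / N x)) \<longlongrightarrow> 0) at_bot))"

end

theory Submission
  imports Defs
begin

text \<open>Write \<open>A\<^sub>n = M\<^sub>0 \<cdots> M\<^sub>n\<^sub>-\<^sub>1\<close>. The columns of \<open>A\<^sub>n\<close> lie within \<open>O (\<delta>\<^sub>2 (A\<^sub>n))\<close> of a line, which one may take to be
  spanned by the positive vector \<open>s\<^sub>n = A\<^sub>n 1\<close>. The direction of \<open>s\<^sub>n\<close> changes in one step by at most
  a multiple of \<open>\<delta>\<^sub>2 (A\<^sub>n) \<parallel>M\<^sub>n\<parallel> / \<parallel>s\<^sub>n\<^sub>+\<^sub>1\<parallel>\<close>; the Pisot and growth conditions make \<open>\<delta>\<^sub>2 (A\<^sub>n) \<parallel>M\<^sub>n\<parallel>\<close>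
  summable, so the direction converges fast enough for strong convergence. Reversing time and
  transposing gives \<open>v\<close>. On the hyperplanes \<open>v\<^sub>n\<^sup>\<bottom>\<close> both contraction statements express strong convergence
  (together with \<open>u \<bullet> v > 0\<close> for the future), while along \<open>u\<^sub>n\<close> they follow from the divergence of the
  column and row sums of products of positive integer matrices.\<close>

text \<open>Convergence of directions alone is too weak: the columns of \<open>A\<^sub>n\<close> may
  grow, and their absolute distance to the limit line must still vanish. Errors in direction are
  therefore always weighted by the size of the row-sum vector. The growth condition enters because
  \<open>\<delta>\<^sub>2 (A\<^sub>n)\<close> controls \<open>A\<^sub>n\<close> on vectors of
  bounded size, whereas the next product applies \<open>A\<^sub>n\<close> to the columns of
  \<open>M\<^sub>n\<close>; exponential decay absorbs subexponential growth. The vector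
  \<open>s\<^sub>n\<close> is preferred to a singular direction because it stays in the nested
  cones, so its limiting direction lies in their intersection. Integrality makes this intersection a
  single ray: every column has coordinate sum at least 1, so a point of the cone has bounded
  coefficients over columns that are all close to the ray. As \<open>delta2\<close> is read off the
  roots of a characteristic polynomial, the spectral theorem is needed with multiplicities, which is
  the reason for the eigenbasis and the factorisation below.\<close>

section \<open>Symmetric matrices and the second singular value\<close>

text \<open>On a subspace that \<open>S\<close> leaves invariant, a maximiser \<open>x\<close> of the Rayleigh quotient is an
  eigenvector: the form \<open>l * (y \<bullet> y) - y \<bullet> (S *v y)\<close> is nonnegative and vanishes at \<open>x\<close>, so that
  \<open>l *\<^sub>R x - S *v x\<close> is orthogonal to the subspace, to which it belongs.\<close>

lemma symmetric_eigenvector_in_invariant_subspace: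
  fixes S :: "real^'n^'n"
  assumes S: "transpose S = S" and W: "subspace W" and inv: "\<And>x. x \<in> W \<Longrightarrow> S *v x \<in> W"
    and nz: "x0 \<in> W" "x0 \<noteq> 0"
  shows "\<exists>x l. x \<in> W \<and> norm x = 1 \<and> S *v x = l *\<^sub>R x"
proof -
  define K where "K = sphere 0 1 \<inter> W"
  have "compact K"
    unfolding K_def by (intro compact_Int_closed compact_sphere closed_subspace W)
  moreover have "x0 /\<^sub>R norm x0 \<in> K"
    using nz W by (auto simp: K_def subspace_scale)
  moreover have "continuous_on K (\<lambda>x. x \<bullet> (S *v x))"
    by (intro continuous_intros)
  ultimately obtain x where x: "x \<in> K" and max: "\<And>y. y \<in> K \<Longrightarrow> y \<bullet> (S *v y) \<le> x \<bullet> (S *v x)"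
    using continuous_attains_sup[of K "\<lambda>x. x \<bullet> (S *v x)"] by blast
  define l where "l = x \<bullet> (S *v x)"
  have xW: "x \<in> W" and nx: "norm x = 1" using x by (auto simp: K_def)
  then have xx: "x \<bullet> x = 1" by (simp add: dot_square_norm)
  have sym: "y \<bullet> (S *v z) = z \<bullet> (S *v y)" for y z
    using S dot_lmul_matrix[of y S z] by (simp add: inner_commute flip: transpose_matrix_vector)
  have le: "y \<bullet> (S *v y) \<le> l * (y \<bullet> y)" if "y \<in> W" for y
  proof (cases "y = 0")
    case False
    have "y /\<^sub>R norm y \<in> K" using that False W by (auto simp: K_def subspace_scale)
    from max[OF this] show ?thesis
      using False
      by (simp add: l_def matrix_vector_mult_scaleR dot_square_norm field_simps power2_eq_square)
  qed simp
  have orth: "z \<bullet> (l *\<^sub>R x - S *v x) = 0" if z: "z \<in> W" for z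
  proof -
    define B where "B = z \<bullet> (l *\<^sub>R x - S *v x)"
    define Q where "Q = l * (z \<bullet> z) - z \<bullet> (S *v z)"
    have "Q \<ge> 0" using le[OF z] by (simp add: Q_def)
    have ineq: "0 \<le> 2 * t * B + t\<^sup>2 * Q" for t
    proof -
      have "x + t *\<^sub>R z \<in> W" using xW z W by (simp add: subspace_add subspace_scale)
      from le[OF this] have "0 \<le> l * ((x + t *\<^sub>R z) \<bullet> (x + t *\<^sub>R z)) - (x + t *\<^sub>R z) \<bullet> (S *v (x + t *\<^sub>R z))"
        by simp
      also have "\<dots> = 2 * t * B + t\<^sup>2 * Q"
        using xx sym[of x z] inner_commute[of x z]
        by (simp add: B_def Q_def l_def[symmetric] inner_add_left inner_add_right inner_diff_right
            matrix_vector_right_distrib matrix_vector_mult_scaleR power2_eq_square algebra_simps)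
      finally show ?thesis .
    qed
    have "B = 0"
    proof (rule ccontr)
      assume "B \<noteq> 0"
      \<comment> \<open>The quadratic is smallest at \<open>- B / Q\<close>; the denominator
        \<open>Q + 1\<close> also covers \<open>Q = 0\<close> and still gives a negative
        value.\<close>
      have "0 \<le> 2 * (- B / (Q + 1)) * B + (- B / (Q + 1))\<^sup>2 * Q" by (rule ineq)
      also have "\<dots> = - (B\<^sup>2 * (Q + 2)) / (Q + 1)\<^sup>2"
        using \<open>Q \<ge> 0\<close> by (simp add: divide_simps power2_eq_square) (simp add: algebra_simps)
      also have "\<dots> < 0"
        using \<open>Q \<ge> 0\<close> \<open>B \<noteq> 0\<close> by (simp add: divide_less_0_iff zero_less_mult_iff)
      finally show False by simp
    qed
    then show ?thesis by (simp add: B_def)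
  qed
  have "l *\<^sub>R x - S *v x \<in> W" using xW W inv by (simp add: subspace_diff subspace_scale)
  from orth[OF this] have "S *v x = l *\<^sub>R x" by simp
  then show ?thesis using xW nx by blast
qed

text \<open>By symmetry the orthogonal complement of the eigenvectors found so far is invariant, and
  it is nonzero while there are fewer than \<open>CARD('n)\<close> of them. The previous lemma then
  supplies one more.\<close>

lemma symmetric_orthonormal_eigenvectors:
  fixes S :: "real^'n^'n"
  assumes S: "transpose S = S" and "k \<le> CARD('n)"
  shows "\<exists>B. finite B \<and> card B = k \<and> pairwise orthogonal B \<and>
    (\<forall>x\<in>B. norm x = 1 \<and> (\<exists>l. S *v x = l *\<^sub>R x))"
  using assms(2)
proof (induction k)
  case 0
  show ?case by (intro exI[of _ "{}"]) simp
next
  case (Suc k)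
  then obtain B where B: "finite B" "card B = k" "pairwise orthogonal B"
    "\<And>x. x \<in> B \<Longrightarrow> norm x = 1" "\<And>x. x \<in> B \<Longrightarrow> \<exists>l. S *v x = l *\<^sub>R x"
    by auto
  define W where "W = orthogonal_comp B"
  have "dim B < DIM(real^'n)"
    using dim_le_card'[OF B(1)] B(2) Suc.prems by simp
  then obtain x0 where "x0 \<noteq> 0" "\<And>y. y \<in> span B \<Longrightarrow> orthogonal x0 y"
    by (rule orthogonal_to_subspace_exists) auto
  then have x0: "x0 \<in> W" "x0 \<noteq> 0"
    by (auto simp: W_def orthogonal_comp_def span_base orthogonal_commute)
  have "S *v x \<in> W" if "x \<in> W" for x
    unfolding W_def orthogonal_comp_def orthogonal_def mem_Collect_eq
  proof
    fix y assume "y \<in> B"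
    then obtain l where l: "S *v y = l *\<^sub>R y" using B(5) by blast
    have "y \<bullet> (S *v x) = (S *v y) \<bullet> x"
      using S dot_lmul_matrix[of y S x] by (simp flip: transpose_matrix_vector)
    also have "\<dots> = 0"
      using that \<open>y \<in> B\<close> l by (simp add: W_def orthogonal_comp_def orthogonal_def)
    finally show "y \<bullet> (S *v x) = 0" .
  qed
  from symmetric_eigenvector_in_invariant_subspace[OF S _ this x0]
  obtain x l where x: "x \<in> W" "norm x = 1" "S *v x = l *\<^sub>R x"
    by (auto simp: W_def subspace_orthogonal_comp)
  have "x \<notin> B"
    using x by (auto simp: W_def orthogonal_comp_def orthogonal_def dot_square_norm)
  moreover have "pairwise orthogonal (insert x B)"
    using B(3) x(1) by (auto simp: pairwise_insert W_def orthogonal_comp_def orthogonal_commute)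
  ultimately show ?case
    using B x by (intro exI[of _ "insert x B"]) auto
qed

lemma symmetric_eigenbasis:
  fixes S :: "real^'n^'n"
  assumes S: "transpose S = S"
  obtains P :: "real^'n^'n" and l :: "'n \<Rightarrow> real"
  where "orthogonal_matrix P" "\<And>i. S *v column i P = l i *\<^sub>R column i P"
proof -
  obtain B where B: "finite B" "card B = CARD('n)" "pairwise orthogonal B"
    "\<And>x. x \<in> B \<Longrightarrow> norm x = 1" "\<And>x. x \<in> B \<Longrightarrow> \<exists>l. S *v x = l *\<^sub>R x"
    using symmetric_orthonormal_eigenvectors[OF S order_refl] by auto
  obtain b :: "'n \<Rightarrow> real^'n" where b: "bij_betw b UNIV B"
    using finite_same_card_bij[of "UNIV :: 'n set" B] B by auto
  define P where "P = (\<chi> i j. b j $ i)"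
  have col: "column i P = b i" for i by (simp add: P_def column_def vec_eq_iff)
  have bB: "b i \<in> B" for i using b by (auto simp: bij_betw_def)
  have "orthogonal_matrix P"
    unfolding orthogonal_matrix_orthonormal_columns col
    using B(3,4) bB b by (auto simp: pairwise_def bij_betw_def inj_eq)
  moreover obtain l where "\<And>i. S *v b i = l i *\<^sub>R b i"
    using choice[of "\<lambda>i l. S *v b i = l *\<^sub>R b i"] B(5) bB by blast
  ultimately show ?thesis using that[of P l] by (simp add: col)
qed

text \<open>The eigenvector equations say \<open>S ** P = P ** D\<close> with \<open>D\<close>
  diagonal. Embedding constants as polynomials by \<open>C\<close> respects products, so the
  relation passes to \<open>X S\<close> and \<open>X D\<close>. The factor \<open>det (C P)\<close>
  is nonzero because \<open>P\<close> is orthogonal, and it cancels since real polynomials form an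
  integral domain.\<close>

lemma charpoly_eq_prod_eigenvalues:
  fixes S P :: "real^'n^'n"
  assumes P: "orthogonal_matrix P" and eig: "\<And>i. S *v column i P = l i *\<^sub>R column i P"
  shows "charpoly S = (\<Prod>i\<in>UNIV. [:- l i, 1:])"
proof -
  define C :: "real^'n^'n \<Rightarrow> real poly^'n^'n" where "C = (\<lambda>A. \<chi> i j. [:A $ i $ j:])"
  define X :: "real^'n^'n \<Rightarrow> real poly^'n^'n"
    where "X = (\<lambda>A. \<chi> i j. (if i = j then [:0, 1:] else 0) - [:A $ i $ j:])"
  define D where "D = (\<chi> i j. if i = j then l i else 0)"
  have sum_const: "[:sum f I:] = (\<Sum>i\<in>I. [:f i:])" if "finite I" for f :: "'n \<Rightarrow> real" and I
    using that
  proof (induction I)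
    case (insert i I)
    have "[:f i + sum f I:] = [:f i:] + [:sum f I:]" by simp
    then show ?case using insert by simp
  qed simp
  have C_mult: "C (A ** B) = C A ** C B" for A B
    by (simp add: C_def matrix_matrix_mult_def vec_eq_iff sum_const mult.commute)
  have SP: "S ** P = P ** D"
  proof -
    have "(S ** P) $ i $ j = (P ** D) $ i $ j" for i j
    proof -
      have "(S ** P) $ i $ j = (S *v column j P) $ i"
        by (simp add: matrix_matrix_mult_def matrix_vector_mult_def column_def)
      also have "\<dots> = l j * P $ i $ j" by (simp only: eig) (simp add: column_def)
      also have "\<dots> = (P ** D) $ i $ j"
        by (simp add: matrix_matrix_mult_def D_def if_distrib[of "(*) _"] cong: if_cong)
      finally show ?thesis .
    qed
    then show ?thesis by (simp add: vec_eq_iff)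
  qed
  have X: "X A = (\<chi> i j. if i = j then [:0, 1:] else 0) - C A" for A
    by (simp add: X_def C_def vec_eq_iff)
  have comm: "(\<chi> i j. if i = j then [:0, 1:] else 0) ** A = A ** (\<chi> i j. if i = j then [:0, 1:] else 0)"
    for A :: "real poly^'n^'n"
    by (simp add: matrix_matrix_mult_def vec_eq_iff if_distrib[of "\<lambda>x. x * _"] if_distrib[of "\<lambda>x. _ * x"]
        mult.commute cong: if_cong)
  have sub1: "(A - B) ** E = A ** E - B ** E" for A B E :: "real poly^'n^'n"
    by (simp add: matrix_matrix_mult_def vec_eq_iff sum_subtractf left_diff_distrib)
  have sub2: "E ** (A - B) = E ** A - E ** B" for A B E :: "real poly^'n^'n"
    by (simp add: matrix_matrix_mult_def vec_eq_iff sum_subtractf right_diff_distrib)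
  have "X S ** C P = C P ** X D"
    unfolding X sub1 sub2 comm C_mult[symmetric] SP ..
  then have "det (X S) * det (C P) = det (C P) * det (X D)"
    by (metis det_mul)
  moreover have "det (C P) \<noteq> 0"
  proof -
    have "C (transpose P) ** C P = mat 1"
      using P unfolding orthogonal_matrix C_mult[symmetric]
      by (simp add: C_def mat_def vec_eq_iff one_pCons)
    then have "det (C (transpose P)) * det (C P) = 1" by (metis det_mul det_I)
    then show ?thesis by auto
  qed
  ultimately have "det (X S) = det (X D)" by (simp add: mult.commute)
  also have "\<dots> = (\<Prod>i\<in>UNIV. [:- l i, 1:])"
    by (subst det_diagonal) (auto simp: X_def D_def)
  finally show ?thesis by (simp add: charpoly_def X_def)
qed

text \<open>Only one index is removed from the multiset of singular values, one that carries the
  largest. If that value is repeated, a copy remains and is itself \<open>delta2 A\<close>. At least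
  two values are present, so position 1 of the list is meaningful.\<close>

lemma all_but_one_le_delta2:
  fixes A P :: "real^'n^'n"
  assumes P: "orthogonal_matrix P"
    and eig: "\<And>i. (transpose A ** A) *v column i P = l i *\<^sub>R column i P"
    and "CARD('n) \<ge> 2"
  shows "\<exists>i0. \<forall>i. i \<noteq> i0 \<longrightarrow> sqrt (l i) \<le> delta2 A"
proof -
  have "proots (\<Prod>i\<in>I. [:- l i, 1:]) = image_mset l (mset_set I)" if "finite I" for I
    using that
  proof (induction I)
    case (insert i I)
    have "(\<Prod>i\<in>I. [:- l i, 1:]) \<noteq> 0" using insert(1) by simp
    then have "proots ([:- l i, 1:] * (\<Prod>i\<in>I. [:- l i, 1:])) = {#l i#} + proots (\<Prod>i\<in>I. [:- l i, 1:])"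
      by (subst proots_mult) (auto simp del: mult_pCons_left)
    then show ?case using insert by (simp del: mult_pCons_left)
  qed simp
  then have sv: "singular_values A = image_mset (\<lambda>i. sqrt (l i)) (mset_set UNIV)"
    by (simp add: singular_values_def charpoly_eq_prod_eigenvalues[OF P eig] multiset.map_comp o_def)
  define ys where "ys = rev (sorted_list_of_multiset (singular_values A))"
  have mys: "mset ys = image_mset (\<lambda>i. sqrt (l i)) (mset_set UNIV)" by (simp add: ys_def sv)
  have "length ys \<ge> 2" using assms(3) size_mset[of ys] by (simp add: mys)
  then obtain y0 y1 zs where ys: "ys = y0 # y1 # zs"
    by (metis One_nat_def Suc_le_length_iff numeral_2_eq_2)
  have "sorted (rev ys)" by (simp add: ys_def)
  then have le: "y \<le> y1" if "y \<in> set (y1 # zs)" for y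
    using that by (auto simp: ys sorted_append)
  obtain i0 where i0: "y0 = sqrt (l i0)"
  proof -
    have "y0 \<in># mset ys" by (simp add: ys)
    then show ?thesis using that unfolding mys by auto
  qed
  have "mset_set UNIV = add_mset i0 (mset_set (UNIV - {i0}))"
    by (simp add: mset_set.remove)
  then have rest: "mset (y1 # zs) = image_mset (\<lambda>i. sqrt (l i)) (mset_set (UNIV - {i0}))"
    using mys by (simp add: ys i0)
  have "sqrt (l i) \<le> delta2 A" if "i \<noteq> i0" for i
  proof -
    have "sqrt (l i) \<in># mset (y1 # zs)" unfolding rest using that by auto
    then have "sqrt (l i) \<le> y1" using le by (metis set_mset_mset)
    then show ?thesis by (simp add: delta2_def flip: ys_def) (simp add: ys)
  qed
  then show ?thesis by blast
qed

text \<open>In an orthonormal eigenbasis of \<open>transpose A ** A\<close> the images under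
  \<open>A\<close> are orthogonal with squared lengths \<open>l i\<close>. The vector
  \<open>w\<close> is the image of the one exceptional basis vector, and
  \<open>a *\<^sub>R w\<close> is the orthogonal projection of \<open>A *v x\<close> to its line;
  the remainder meets only eigenvalues of at most \<open>(delta2 A)\<^sup>2\<close>. The size bound
  on the projection later controls products of errors with main terms.\<close>

lemma near_line_delta2:
  fixes A :: "real^'n^'n"
  assumes "CARD('n) \<ge> 2"
  shows "\<exists>w. \<forall>x. \<exists>a. norm (a *\<^sub>R w) \<le> norm (A *v x) \<and> norm (A *v x - a *\<^sub>R w) \<le> delta2 A * norm x"
proof -
  define S where "S = transpose A ** A"
  have "transpose S = S" by (simp add: S_def matrix_transpose_mul)
  then obtain P l where P: "orthogonal_matrix P" and eig: "\<And>i. S *v column i P = l i *\<^sub>R column i P"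
    by (rule symmetric_eigenbasis) blast
  from all_but_one_le_delta2[OF P _ assms, of A l] eig
  obtain i0 where i0: "\<And>i. i \<noteq> i0 \<Longrightarrow> sqrt (l i) \<le> delta2 A" by (auto simp: S_def)
  define b where "b i = column i P" for i
  have orth: "b i \<bullet> b j = (if i = j then 1 else 0)" for i j
    using P unfolding orthogonal_matrix_orthonormal_columns b_def
    by (auto simp: orthogonal_def dot_square_norm)
  have A_inner: "(A *v b i) \<bullet> (A *v b j) = (if i = j then l i else 0)" for i j
  proof -
    have "(A *v b i) \<bullet> (A *v b j) = b j \<bullet> (transpose A *v (A *v b i))"
      by (metis dot_lmul_matrix inner_commute transpose_matrix_vector)
    also have "\<dots> = b j \<bullet> (S *v b i)" by (simp add: S_def matrix_vector_mul_assoc)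
    also have "\<dots> = (if i = j then l i else 0)" by (auto simp: eig[folded b_def] orth)
    finally show ?thesis .
  qed
  have l_nonneg: "l i \<ge> 0" for i using A_inner[of i i] by (metis inner_ge_zero)
  have expand: "x = (\<Sum>i\<in>UNIV. (x \<bullet> b i) *\<^sub>R b i)" for x
  proof -
    have "x = (P ** transpose P) *v x" using P by (simp add: orthogonal_matrix_def)
    also have "\<dots> = P *v (transpose P *v x)"
      by (rule matrix_vector_mul_assoc[symmetric])
    also have "transpose P *v x = (\<chi> i. x \<bullet> b i)"
      by (simp add: matrix_vector_mult_def transpose_def b_def column_def inner_vec_def mult.commute)
    also have "P *v \<dots> = (\<Sum>i\<in>UNIV. (x \<bullet> b i) *\<^sub>R b i)"
      by (simp add: matrix_mult_sum b_def scalar_mult_eq_scaleR)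
    finally show ?thesis .
  qed
  have normA: "norm (A *v x) ^ 2 = (\<Sum>i\<in>UNIV. (x \<bullet> b i)\<^sup>2 * l i)" for x
  proof -
    have "A *v x = (\<Sum>i\<in>UNIV. (x \<bullet> b i) *\<^sub>R (A *v b i))"
      using arg_cong[OF expand[of x], of "(*v) A"]
      by (simp add: linear_sum[OF matrix_vector_mul_linear] matrix_vector_mult_scaleR)
    then have "norm (A *v x) ^ 2 = (\<Sum>i\<in>UNIV. \<Sum>j\<in>UNIV. (x \<bullet> b i) * ((x \<bullet> b j) * ((A *v b j) \<bullet> (A *v b i))))"
      by (simp add: inner_sum_left inner_sum_right sum_distrib_left flip: dot_square_norm)
    also have "\<dots> = (\<Sum>i\<in>UNIV. (x \<bullet> b i)\<^sup>2 * l i)"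
      by (simp add: A_inner power2_eq_square mult.assoc if_distrib[of "(*) _"] cong: if_cong)
    finally show ?thesis .
  qed
  have normx: "norm x ^ 2 = (\<Sum>i\<in>UNIV. (x \<bullet> b i)\<^sup>2)" for x
  proof -
    have "norm x ^ 2 = x \<bullet> (\<Sum>i\<in>UNIV. (x \<bullet> b i) *\<^sub>R b i)"
      using arg_cong[OF expand[of x], of "(\<bullet>) x"] by (simp add: dot_square_norm)
    then show ?thesis by (simp add: inner_sum_right power2_eq_square)
  qed
  define w where "w = A *v b i0"
  show ?thesis
  proof (intro exI[of _ w] allI)
    fix x
    define a where "a = x \<bullet> b i0"
    define y where "y = x - a *\<^sub>R b i0"
    have y: "y \<bullet> b i = (if i = i0 then 0 else x \<bullet> b i)" for i
      by (auto simp: y_def a_def inner_diff_left orth)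
    have "norm (a *\<^sub>R w) ^ 2 = a\<^sup>2 * l i0"
      by (simp add: w_def A_inner power_mult_distrib flip: dot_square_norm)
    also have "\<dots> \<le> norm (A *v x) ^ 2"
      unfolding normA a_def by (rule member_le_sum) (auto simp: l_nonneg)
    finally have 1: "norm (a *\<^sub>R w) \<le> norm (A *v x)" by (simp add: power2_le_iff_abs_le)
    \<comment> \<open>A second index is wanted because its nonnegative singular value yields
      \<open>delta2 A \<ge> 0\<close>.\<close>
    have "\<exists>i1. i1 \<noteq> i0"
    proof (rule ccontr)
      assume "\<nexists>i1. i1 \<noteq> i0"
      then have "(UNIV :: 'n set) = {i0}" by auto
      then have "CARD('n) = card {i0}" by (rule arg_cong)
      then show False using assms by simp
    qed
    then obtain i1 where "i1 \<noteq> i0" by blast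
    then have d0: "delta2 A \<ge> 0" using i0 l_nonneg by (meson order_trans real_sqrt_ge_zero)
    have "norm (A *v y) ^ 2 \<le> (\<Sum>i\<in>UNIV. (delta2 A)\<^sup>2 * (y \<bullet> b i)\<^sup>2)"
      unfolding normA
    proof (rule sum_mono)
      fix i
      have "l i \<le> (delta2 A)\<^sup>2" if "i \<noteq> i0"
        using i0[OF that] l_nonneg[of i] by (simp add: sqrt_le_D)
      then show "(y \<bullet> b i)\<^sup>2 * l i \<le> (delta2 A)\<^sup>2 * (y \<bullet> b i)\<^sup>2"
        by (cases "i = i0") (auto simp: y mult.commute intro: mult_right_mono)
    qed
    also have "\<dots> = (delta2 A)\<^sup>2 * norm y ^ 2" by (simp add: normx sum_distrib_left)
    also have "\<dots> \<le> (delta2 A)\<^sup>2 * norm x ^ 2"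
    proof (rule mult_left_mono)
      show "norm y ^ 2 \<le> norm x ^ 2"
        unfolding normx by (rule sum_mono) (auto simp: y)
    qed simp
    finally have "norm (A *v y) ^ 2 \<le> (delta2 A * norm x) ^ 2" by (simp add: power_mult_distrib)
    then have "norm (A *v y) \<le> delta2 A * norm x" using d0 by (simp add: power2_le_iff_abs_le)
    moreover have "A *v y = A *v x - a *\<^sub>R w"
      by (simp add: y_def w_def matrix_vector_mult_diff_distrib matrix_vector_mult_scaleR)
    ultimately show "\<exists>a. norm (a *\<^sub>R w) \<le> norm (A *v x) \<and> norm (A *v x - a *\<^sub>R w) \<le> delta2 A * norm x"
      using 1 by auto
  qed
qed

section \<open>Norms on a Euclidean space\<close>

text \<open>Expansion in the basis gives the upper bound, which makes \<open>N\<close> Lipschitz and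
  hence continuous. The lower constant is its minimum on the compact unit sphere, positive by
  definiteness.\<close>

lemma is_norm_equivalent:
  fixes N :: "'a::euclidean_space \<Rightarrow> real"
  assumes "is_norm N"
  obtains c C where "c > 0" "C > 0" "\<And>x. c * norm x \<le> N x" "\<And>x. N x \<le> C * norm x"
proof -
  have zero: "N x = 0 \<longleftrightarrow> x = 0" and scale: "N (a *\<^sub>R x) = \<bar>a\<bar> * N x"
    and tri: "N (x + y) \<le> N x + N y" for x y a
    using assms by (auto simp: is_norm_def)
  have uminus: "N (- x) = N x" for x using scale[of "-1" x] by simp
  have nonneg: "N x \<ge> 0" for x using tri[of x "- x"] zero[of 0] by (simp add: uminus)
  define C where "C = (\<Sum>b\<in>Basis. N b) + 1"
  have "C > 0" using sum_nonneg[of Basis N] nonneg by (simp add: C_def)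
  have N_sum: "N (sum f I) \<le> (\<Sum>i\<in>I. N (f i))" if "finite I" for f :: "'a \<Rightarrow> 'a" and I
    using that
  proof (induction I)
    case (insert i I)
    then show ?case using tri[of "f i" "sum f I"] by simp
  qed (simp add: zero[THEN iffD2])
  have upper: "N x \<le> C * norm x" for x
  proof -
    have "N x = N (\<Sum>b\<in>Basis. (x \<bullet> b) *\<^sub>R b)" by (simp add: euclidean_representation)
    also have "\<dots> \<le> (\<Sum>b\<in>Basis. N ((x \<bullet> b) *\<^sub>R b))" by (rule N_sum) simp
    also have "\<dots> \<le> (\<Sum>b\<in>Basis. norm x * N b)"
      by (intro sum_mono) (simp add: scale mult_right_mono nonneg Basis_le_norm)
    also have "\<dots> = norm x * (\<Sum>b\<in>Basis. N b)" by (simp add: sum_distrib_left)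
    also have "\<dots> \<le> C * norm x" by (simp add: C_def algebra_simps)
    finally show ?thesis .
  qed
  have lip: "\<bar>N x - N y\<bar> \<le> C * norm (x - y)" for x y
    using tri[of y "x - y"] tri[of x "y - x"] upper[of "x - y"] uminus[of "x - y"] by simp
  have "C-lipschitz_on UNIV N"
    using lip \<open>C > 0\<close> by (auto intro!: lipschitz_onI simp: dist_norm)
  then have "continuous_on UNIV N" by (rule lipschitz_on_continuous_on)
  then have "continuous_on (sphere 0 1) N" by (rule continuous_on_subset) simp
  moreover have "(sphere 0 1 :: 'a set) \<noteq> {}" by simp
  ultimately obtain z where z: "z \<in> sphere 0 1" "\<And>y. y \<in> sphere 0 1 \<Longrightarrow> N z \<le> N y"
    using continuous_attains_inf[of "sphere 0 1" N] by auto
  have "N z > 0" using z(1) zero[of z] nonneg[of z] by (cases "N z = 0") auto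
  moreover have "N z * norm x \<le> N x" for x
  proof (cases "x = 0")
    case False
    then have "N z \<le> N (x /\<^sub>R norm x)" by (intro z) simp
    then show ?thesis using False by (simp add: scale field_simps)
  qed (simp add: nonneg)
  ultimately show ?thesis using \<open>C > 0\<close> upper that by blast
qed

section \<open>Nonnegative unimodular matrices\<close>

text \<open>On nonnegative vectors this is the l1 norm, yet it is linear, so the sizes of
  nonnegative combinations add up exactly.\<close>

definition coord_sum :: "real^'n \<Rightarrow> real" where
  "coord_sum x = (\<Sum>i\<in>UNIV. x $ i)"

abbreviation ones :: "real^'n" where
  "ones \<equiv> \<chi> i. 1"

lemma coord_sum_simps [simp]:
  "coord_sum 0 = 0" "coord_sum (x + y) = coord_sum x + coord_sum y"
  "coord_sum (x - y) = coord_sum x - coord_sum y" "coord_sum (a *\<^sub>R x) = a * coord_sum x"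
  "coord_sum (sum f I) = (\<Sum>i\<in>I. coord_sum (f i))"
  by (auto simp: coord_sum_def sum.distrib sum_subtractf sum_distrib_left intro: sum.swap)

lemma abs_coord_sum_le: "\<bar>coord_sum (x :: real^'n)\<bar> \<le> CARD('n) * norm x"
proof -
  have "\<bar>coord_sum x\<bar> \<le> (\<Sum>i\<in>UNIV. \<bar>x $ i\<bar>)" by (simp add: coord_sum_def)
  also have "\<dots> \<le> (\<Sum>i\<in>(UNIV :: 'n set). norm x)" by (intro sum_mono component_le_norm_cart)
  finally show ?thesis by simp
qed

lemma norm_le_coord_sum:
  assumes "\<And>i. x $ i \<ge> 0"
  shows "norm x \<le> coord_sum x"
  using norm_le_l1_cart[of x] assms by (simp add: coord_sum_def)

lemma coord_sum_nonneg: "(\<And>i. x $ i \<ge> 0) \<Longrightarrow> coord_sum x \<ge> 0"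
  by (simp add: coord_sum_def sum_nonneg)

lemma coord_sum_mono: "(\<And>i. x $ i \<le> y $ i) \<Longrightarrow> coord_sum x \<le> coord_sum y"
  by (simp add: coord_sum_def sum_mono)

lemma component_le_coord_sum: "(\<And>i. x $ i \<ge> 0) \<Longrightarrow> x $ i \<le> coord_sum x"
  by (simp add: coord_sum_def member_le_sum)

lemma mult_axis: "(A *v axis j 1) $ i = (A $ i $ j :: real)"
  by (simp add: matrix_vector_mult_basis column_def)

lemma mult_vec_eq_sum_columns: "A *v x = (\<Sum>j\<in>UNIV. x $ j *\<^sub>R (A *v axis j (1 :: real)))"
  unfolding matrix_vector_mult_basis by (simp add: matrix_mult_sum scalar_mult_eq_scaleR)

lemma mult_vec_nonneg:
  assumes "\<And>i j. (A :: real^'n^'m) $ i $ j \<ge> 0" "\<And>j. x $ j \<ge> 0"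
  shows "(A *v x) $ i \<ge> 0"
  using assms by (simp add: matrix_vector_mult_def sum_nonneg)

lemma mult_vec_mono:
  assumes "\<And>i j. (A :: real^'n^'m) $ i $ j \<ge> 0" "\<And>j. x $ j \<le> y $ j"
  shows "(A *v x) $ i \<le> (A *v y) $ i"
  using assms by (simp add: matrix_vector_mult_def sum_mono mult_left_mono)

lemma nonneg_unimodular_entry_nonneg: "A \<in> nonneg_unimodular \<Longrightarrow> A $ i $ j \<ge> 0"
  by (simp add: nonneg_unimodular_def) (metis Nats_cases of_nat_0_le_iff)

lemma nonneg_unimodular_invertible: "A \<in> nonneg_unimodular \<Longrightarrow> invertible A"
  by (auto simp: nonneg_unimodular_def invertible_det_nz)

lemma nonneg_unimodular_one: "mat 1 \<in> nonneg_unimodular"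
  by (simp add: nonneg_unimodular_def) (simp add: mat_def)

lemma nonneg_unimodular_mult:
  assumes "A \<in> nonneg_unimodular" "B \<in> nonneg_unimodular"
  shows "A ** B \<in> nonneg_unimodular"
proof -
  have "sum f I \<in> \<nat>" if "finite I" "\<And>i. f i \<in> \<nat>" for f :: "'a \<Rightarrow> real" and I
    using that by (induction I) auto
  then have "(A ** B) $ i $ j \<in> \<nat>" for i j
    using assms by (simp add: nonneg_unimodular_def matrix_matrix_mult_def)
  then show ?thesis using assms by (auto simp: nonneg_unimodular_def det_mul)
qed

lemma nonneg_unimodular_transpose: "A \<in> nonneg_unimodular \<Longrightarrow> transpose A \<in> nonneg_unimodular"
  by (simp add: nonneg_unimodular_def) (simp add: transpose_def)

text \<open>Invertibility forbids a zero column, and integrality turns a positive entry into one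
  that is at least 1.\<close>

lemma nonneg_unimodular_column_ge_1:
  assumes A: "A \<in> nonneg_unimodular"
  shows "\<exists>i. A $ i $ j \<ge> 1"
proof (rule ccontr)
  assume neg: "\<nexists>i. A $ i $ j \<ge> 1"
  have "A $ i $ j = 0" for i
  proof -
    have "A $ i $ j \<in> \<nat>" using A by (simp add: nonneg_unimodular_def)
    then obtain k :: nat where k: "A $ i $ j = real k" by (auto elim: Nats_cases)
    have "A $ i $ j < 1" using neg by (simp add: not_le)
    then show ?thesis using k by simp
  qed
  then have "column j A = 0" by (simp add: column_def vec_eq_iff)
  then have "det A = 0" by (rule det_zero_column)
  then show False using A by (simp add: nonneg_unimodular_def)
qed

lemma nonneg_unimodular_column_sum_ge_1:
  assumes A: "A \<in> nonneg_unimodular"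
  shows "coord_sum (A *v axis j 1) \<ge> 1"
proof -
  obtain i where "A $ i $ j \<ge> 1" using nonneg_unimodular_column_ge_1[OF A] by blast
  also have "A $ i $ j \<le> coord_sum (A *v axis j 1)"
    using component_le_coord_sum[of "A *v axis j 1" i] nonneg_unimodular_entry_nonneg[OF A]
    by (simp add: mult_axis)
  finally show ?thesis .
qed

lemma nonneg_unimodular_row_sum_ge_1:
  assumes A: "A \<in> nonneg_unimodular"
  shows "(A *v ones) $ i \<ge> 1"
proof -
  obtain j where "transpose A $ j $ i \<ge> 1"
    using nonneg_unimodular_column_ge_1[OF nonneg_unimodular_transpose[OF A]] by blast
  also have "transpose A $ j $ i = A $ i $ j" by (simp add: transpose_def)
  also have "A $ i $ j \<le> (A *v ones) $ i"
    using member_le_sum[of j UNIV "\<lambda>j. A $ i $ j"] nonneg_unimodular_entry_nonneg[OF A]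
    by (simp add: matrix_vector_mult_def)
  finally show ?thesis .
qed

section \<open>Products of consecutive matrices\<close>

lemma mprod_empty: "n \<le> m \<Longrightarrow> mprod M m n = mat 1"
  by (simp add: mprod_def)

lemma mprod_mult:
  assumes "a \<le> b" "b \<le> c"
  shows "mprod M a b ** mprod M b c = mprod M a c"
proof (cases "b = c")
  case False
  have *: "foldr (\<lambda>k A. M k ** A) ks (mat 1) ** B = foldr (\<lambda>k A. M k ** A) ks B" for ks B
    by (induction ks) (auto simp flip: matrix_mul_assoc)
  have "[a..c - 1] = [a..b - 1] @ [b..c - 1]" using assms False by (intro upto_split1) auto
  then show ?thesis by (simp add: mprod_def *)
qed (simp add: mprod_empty)

lemma mprod_single: "mprod M n (n + 1) = M n"
  by (simp add: mprod_def)

lemma mprod_rec_right: "m \<le> n \<Longrightarrow> mprod M m (n + 1) = mprod M m n ** M n"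
  using mprod_mult[of m n "n + 1" M] by (simp add: mprod_single)

lemma mprod_rec_left: "m \<le> n \<Longrightarrow> mprod M (m - 1) n = M (m - 1) ** mprod M m n"
  using mprod_mult[of "m - 1" m n M] mprod_single[of M "m - 1"] by simp

lemma mprod_nonneg_unimodular:
  assumes "\<And>n. M n \<in> nonneg_unimodular"
  shows "mprod M m n \<in> nonneg_unimodular"
proof -
  have "foldr (\<lambda>k A. M k ** A) ks (mat 1) \<in> nonneg_unimodular" for ks
    by (induction ks) (auto intro: assms nonneg_unimodular_mult nonneg_unimodular_one)
  then show ?thesis by (simp add: mprod_def)
qed

text \<open>The shift in \<open>- n - 1\<close> makes the block \<open>[a, b)\<close> correspond to
  \<open>[- b, - a)\<close>. The past of \<open>M\<close> thereby becomes the future of the reversed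
  sequence.\<close>

lemma mprod_transpose_reversed:
  "mprod (\<lambda>n. transpose (M (- n - 1))) a b = transpose (mprod M (- b) (- a))"
proof (cases "a \<le> b")
  case True
  then show ?thesis
  proof (induction b rule: int_ge_induct)
    case base
    show ?case by (simp add: mprod_empty)
  next
    case (step b)
    then show ?case
      using mprod_rec_left[of "- b" "- a" M] by (simp add: mprod_rec_right matrix_transpose_mul)
  qed
qed (simp add: mprod_empty)

section \<open>Strong convergence\<close>

text \<open>For \<open>a\<close> the column,
  \<open>coord_sum s *\<^sub>R a - coord_sum a *\<^sub>R s\<close> is bilinear, vanishes on parallel
  vectors and needs no division. As \<open>s\<close> and \<open>a\<close> are both close to the line
  of \<open>w\<close>, only error terms survive. The factor \<open>coord_sum s\<close> on the right
  cancels once \<open>s\<close> is normalised.\<close>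

lemma columns_near_row_sum_direction:
  fixes A :: "real^'n^'n"
  assumes d: "CARD('n) \<ge> 2" and nonneg: "\<And>i j. A $ i $ j \<ge> 0"
  defines "s \<equiv> A *v ones"
  shows "norm (coord_sum s *\<^sub>R (A *v axis j 1) - coord_sum (A *v axis j 1) *\<^sub>R s)
    \<le> 4 * (real CARD('n))\<^sup>2 * delta2 A * coord_sum s"
proof -
  define d where "d = real CARD('n)"
  obtain w where w: "\<And>x. \<exists>a. norm (a *\<^sub>R w) \<le> norm (A *v x) \<and> norm (A *v x - a *\<^sub>R w) \<le> delta2 A * norm x"
    using near_line_delta2[OF d] by blast
  define a where "a = A *v axis j 1"
  obtain \<beta> where \<beta>: "norm (s - \<beta> *\<^sub>R w) \<le> delta2 A * norm (ones :: real^'n)"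
    using w[of ones] by (auto simp: s_def)
  obtain \<alpha> where \<alpha>: "norm (\<alpha> *\<^sub>R w) \<le> norm a" "norm (a - \<alpha> *\<^sub>R w) \<le> delta2 A"
    using w[of "axis j 1"] by (auto simp: a_def)
  define r where "r = s - \<beta> *\<^sub>R w"
  define \<rho> where "\<rho> = a - \<alpha> *\<^sub>R w"
  have "d \<ge> 1" using d by (simp add: d_def)
  have d0: "delta2 A \<ge> 0" using \<alpha>(2) norm_ge_zero order_trans by blast
  have "norm (ones :: real^'n) \<le> d"
    using norm_le_coord_sum[of "ones :: real^'n"] by (simp add: coord_sum_def d_def)
  then have r: "norm r \<le> delta2 A * d"
    using \<beta> mult_left_mono[OF _ d0] by (fastforce simp: r_def)
  have s_nonneg: "s $ i \<ge> 0" and a_nonneg: "a $ i \<ge> 0" for i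
    using mult_vec_nonneg[OF nonneg] by (auto simp: s_def a_def mult_axis nonneg)
  have "a $ i \<le> s $ i" for i
    unfolding s_def a_def by (rule mult_vec_mono[OF nonneg]) (simp add: axis_def)
  then have a_le: "norm a \<le> coord_sum s"
    using norm_le_coord_sum[of a] a_nonneg coord_sum_mono[of a s] by force
  have s_le: "norm s \<le> coord_sum s" using norm_le_coord_sum s_nonneg by blast
  have s0: "coord_sum s \<ge> 0" using s_le norm_ge_zero order_trans by blast
  have \<phi>: "\<bar>coord_sum x\<bar> \<le> d * norm x" for x :: "real^'n"
    using abs_coord_sum_le[of x] by (simp add: d_def)
  define p where "p = \<alpha> *\<^sub>R w"
  \<comment> \<open>The part of \<open>s\<close> along \<open>w\<close> cancels against
    \<open>p\<close>. The surviving \<open>p\<close> is no longer than \<open>a\<close>, by the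
    projection bound of \<open>near_line_delta2\<close>.\<close>
  have "coord_sum s *\<^sub>R a - coord_sum a *\<^sub>R s =
      (coord_sum r *\<^sub>R p - coord_sum p *\<^sub>R r) + (coord_sum s *\<^sub>R \<rho> - coord_sum \<rho> *\<^sub>R s)"
    by (simp add: r_def \<rho>_def p_def algebra_simps)
  then have "norm (coord_sum s *\<^sub>R a - coord_sum a *\<^sub>R s)
      \<le> \<bar>coord_sum r\<bar> * norm p + \<bar>coord_sum p\<bar> * norm r + (\<bar>coord_sum s\<bar> * norm \<rho> + \<bar>coord_sum \<rho>\<bar> * norm s)"
    by (metis (no_types, opaque_lifting) norm_triangle_mono norm_triangle_ineq4 norm_scaleR)
  also have "\<dots> \<le> (d * norm r) * norm p + (d * norm p) * norm r + (coord_sum s * norm \<rho> + (d * norm \<rho>) * norm s)"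
    using s0 by (intro add_mono mult_right_mono \<phi>) auto
  also have "\<dots> = 2 * d * (norm r * norm p) + coord_sum s * norm \<rho> + d * (norm \<rho> * norm s)"
    by (simp add: algebra_simps)
  also have "\<dots> \<le> 2 * d * ((delta2 A * d) * coord_sum s) + coord_sum s * delta2 A + d * (delta2 A * coord_sum s)"
    using \<open>d \<ge> 1\<close> s0 d0 r \<alpha> a_le s_le
    by (intro add_mono mult_left_mono mult_mono) (auto simp: p_def \<rho>_def)
  also have "\<dots> = (2 * d\<^sup>2 + d + 1) * (delta2 A * coord_sum s)"
    by (simp add: algebra_simps power2_eq_square)
  \<comment> \<open>The constant 4 is 2 + 1 + 1, since \<open>d\<close> and 1 are both at most
    \<open>d\<^sup>2\<close>.\<close>
  also have "\<dots> \<le> (4 * d\<^sup>2) * (delta2 A * coord_sum s)"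
  proof (rule mult_right_mono)
    have "1 * d \<le> d * d" "1 * 1 \<le> d * d" using \<open>d \<ge> 1\<close> by (intro mult_mono; simp)+
    then show "2 * d\<^sup>2 + d + 1 \<le> 4 * d\<^sup>2" by (simp add: power2_eq_square)
  qed (simp add: d0 s0)
  finally show ?thesis by (simp add: a_def d_def mult.assoc)
qed

text \<open>The previous estimate is linear in the column, and \<open>A *v x\<close> combines the
  columns with the nonnegative weights \<open>x $ j\<close>.\<close>

lemma image_near_row_sum_direction:
  fixes A :: "real^'n^'n"
  assumes d: "CARD('n) \<ge> 2" and nonneg: "\<And>i j. A $ i $ j \<ge> 0" and x: "\<And>i. x $ i \<ge> 0"
  defines "s \<equiv> A *v ones"
  shows "norm (coord_sum s *\<^sub>R (A *v x) - coord_sum (A *v x) *\<^sub>R s)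
    \<le> 4 * (real CARD('n))\<^sup>2 * delta2 A * coord_sum s * coord_sum x"
proof -
  have "coord_sum s *\<^sub>R (A *v x) - coord_sum (A *v x) *\<^sub>R s =
     (\<Sum>j\<in>UNIV. x $ j *\<^sub>R (coord_sum s *\<^sub>R (A *v axis j 1) - coord_sum (A *v axis j 1) *\<^sub>R s))"
    by (subst (1 2) mult_vec_eq_sum_columns)
      (simp add: scaleR_sum_right scaleR_sum_left sum_subtractf scaleR_diff_right mult.commute)
  also have "norm \<dots> \<le> (\<Sum>j\<in>UNIV. x $ j * (4 * (real CARD('n))\<^sup>2 * delta2 A * coord_sum s))"
    unfolding s_def
    by (intro sum_norm_le) (simp add: x mult_left_mono columns_near_row_sum_direction d nonneg)
  also have "\<dots> = 4 * (real CARD('n))\<^sup>2 * delta2 A * coord_sum s * coord_sum x"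
    by (simp add: coord_sum_def[of x] mult.commute flip: sum_distrib_right)
  finally show ?thesis .
qed

text \<open>The normalised row sums \<open>q n\<close> of the products converge to \<open>u\<close>: consecutive terms differ by
  at most a summand of the given series divided by \<open>coord_sum (s n)\<close>. As \<open>coord_sum (s n)\<close> is
  nondecreasing, even \<open>coord_sum (s n) *\<^sub>R (q n - u)\<close> tends to zero.\<close>

lemma strong_convergence_of_summable:
  fixes M :: "int \<Rightarrow> real^'n^'n"
  assumes d: "CARD('n) \<ge> 2" and M: "\<And>n. M n \<in> nonneg_unimodular"
    and summable: "summable (\<lambda>n. delta2 (mprod M 0 (int n)) * coord_sum (M (int n) *v ones))"
  shows "\<exists>u. generalized_right_eigenvector M u \<and> strong_convergence_future M u"
proof -
  define A where "A n = mprod M 0 (int n)" for n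
  define s where "s n = A n *v ones" for n
  define q where "q n = s n /\<^sub>R coord_sum (s n)" for n
  define K where "K = 4 * (real CARD('n))\<^sup>2"
  define \<delta> where "\<delta> n = K * delta2 (A n)" for n
  define \<eta> where "\<eta> n = \<delta> n * coord_sum (M (int n) *v ones)" for n
  have AU: "A n \<in> nonneg_unimodular" for n
    unfolding A_def by (rule mprod_nonneg_unimodular[OF M])
  have A_nonneg: "A n $ i $ j \<ge> 0" for n i j
    using AU by (rule nonneg_unimodular_entry_nonneg)
  have A_mult: "A n = A m ** mprod M (int m) (int n)" if "m \<le> n" for m n
    using that by (simp add: A_def mprod_mult)
  have A_Suc: "A (Suc n) = A n ** M (int n)" for n
    using mprod_rec_right[of 0 "int n" M] by (simp add: A_def add.commute)
  have s_nonneg: "s n $ i \<ge> 0" for n i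
    unfolding s_def by (rule mult_vec_nonneg[OF A_nonneg]) simp
  have s_ge: "coord_sum (s n) \<ge> 1" for n
  proof -
    have "1 \<le> s n $ undefined" unfolding s_def by (rule nonneg_unimodular_row_sum_ge_1[OF AU])
    also have "\<dots> \<le> coord_sum (s n)" by (rule component_le_coord_sum) (rule s_nonneg)
    finally show ?thesis .
  qed
  have s_pos: "coord_sum (s n) > 0" for n using s_ge[of n] by linarith
  have s_mono: "coord_sum (s m) \<le> coord_sum (s n)" if "m \<le> n" for m n
  proof (rule coord_sum_mono)
    fix i
    have "s n = A m *v (mprod M (int m) (int n) *v ones)"
      by (simp add: s_def A_mult[OF that] matrix_vector_mul_assoc)
    moreover have "(A m *v ones) $ i \<le> (A m *v (mprod M (int m) (int n) *v ones)) $ i"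
      by (rule mult_vec_mono[OF A_nonneg])
        (simp add: nonneg_unimodular_row_sum_ge_1 mprod_nonneg_unimodular M)
    ultimately show "s m $ i \<le> s n $ i" by (simp add: s_def)
  qed
  \<comment> \<open>After division by \<open>coord_sum (s n)\<close> the error depends on the size
    of \<open>x\<close> only, not on that of \<open>A n *v x\<close>.\<close>
  have near: "norm (A n *v x - coord_sum (A n *v x) *\<^sub>R q n) \<le> \<delta> n * coord_sum x"
    if "\<And>i. x $ i \<ge> 0" for n x
  proof -
    have "A n *v x - coord_sum (A n *v x) *\<^sub>R q n =
        (coord_sum (s n) *\<^sub>R (A n *v x) - coord_sum (A n *v x) *\<^sub>R s n) /\<^sub>R coord_sum (s n)"
      using s_pos[of n] by (simp add: q_def scaleR_diff_right divide_inverse_commute mult.commute)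
    also have "norm \<dots> \<le> (\<delta> n * coord_sum (s n) * coord_sum x) / coord_sum (s n)"
      using image_near_row_sum_direction[OF d A_nonneg that, of n] s_pos[of n]
      by (simp add: \<delta>_def K_def divide_inverse_commute flip: s_def)
    finally show ?thesis using s_pos[of n] by simp
  qed
  have q_nonneg: "q n $ i \<ge> 0" for n i
    using s_nonneg[of n i] s_pos[of n] by (simp add: q_def)
  have q_sum: "coord_sum (q n) = 1" for n using s_pos[of n] by (simp add: q_def)
  \<comment> \<open>This is \<open>near\<close> for \<open>x = M (int n) *v ones\<close>, whose
    image is \<open>s (Suc n)\<close>. The weight is taken at an earlier time \<open>m\<close> so
    that it stays fixed when the steps are telescoped in \<open>s_dist\<close>.\<close>
  have step: "coord_sum (s m) * norm (q (Suc n) - q n) \<le> \<eta> n" if "m \<le> n" for m n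
  proof -
    have "s (Suc n) = A n *v (M (int n) *v ones)"
      by (simp add: s_def A_Suc matrix_vector_mul_assoc)
    then have "norm (s (Suc n) - coord_sum (s (Suc n)) *\<^sub>R q n) \<le> \<eta> n"
      using near[of "M (int n) *v ones" n] mult_vec_nonneg[OF nonneg_unimodular_entry_nonneg[OF M]]
      by (simp add: \<eta>_def)
    moreover have "s (Suc n) - coord_sum (s (Suc n)) *\<^sub>R q n = coord_sum (s (Suc n)) *\<^sub>R (q (Suc n) - q n)"
      using s_pos[of "Suc n"] by (simp add: q_def scaleR_diff_right)
    ultimately have "coord_sum (s (Suc n)) * norm (q (Suc n) - q n) \<le> \<eta> n"
      using s_pos[of "Suc n"] by simp
    moreover have "coord_sum (s m) * norm (q (Suc n) - q n) \<le> coord_sum (s (Suc n)) * norm (q (Suc n) - q n)"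
      using that by (intro mult_right_mono s_mono) auto
    ultimately show ?thesis by linarith
  qed
  have \<eta>_nonneg: "\<eta> n \<ge> 0" for n
    using order_trans[OF mult_nonneg_nonneg step[of n n]] s_pos[of n] by simp
  have sum\<eta>: "summable \<eta>"
    using summable_mult[OF summable, of K] by (simp add: \<eta>_def[abs_def] \<delta>_def A_def mult.assoc)
  have "norm (q (Suc n) - q n) \<le> \<eta> n" for n
    using step[of n n] mult_right_mono[OF s_ge[of n], of "norm (q (Suc n) - q n)"] by simp
  then have "summable (\<lambda>n. q (Suc n) - q n)"
    by (intro summable_comparison_test[OF _ sum\<eta>]) auto
  then have "convergent q"
    by (simp add: summable_iff_convergent sum_lessThan_telescope convergent_diff_const_right_iff)
  then obtain u where u: "q \<longlonglongrightarrow> u" by (auto simp: convergent_def)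
  have u_nonneg: "u $ i \<ge> 0" for i
    using u q_nonneg by (intro LIMSEQ_le_const[OF tendsto_vec_nth[OF u]]) auto
  have "(\<lambda>n. coord_sum (q n)) \<longlonglongrightarrow> coord_sum u"
    unfolding coord_sum_def by (intro tendsto_intros u)
  then have u_sum: "coord_sum u = 1" by (simp add: q_sum LIMSEQ_const_iff)
  define T where "T n = (\<Sum>k. \<eta> (k + n))" for n
  have T0: "T \<longlonglongrightarrow> 0" unfolding T_def using sum\<eta> by (rule suminf_exist_split2)
  have s_dist: "coord_sum (s n) * norm (u - q n) \<le> T n" for n
  proof (rule LIMSEQ_le_const2)
    show "(\<lambda>k. coord_sum (s n) * norm (q (k + n) - q n)) \<longlonglongrightarrow> coord_sum (s n) * norm (u - q n)"
      by (intro tendsto_intros LIMSEQ_ignore_initial_segment u)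
    have "coord_sum (s n) * norm (q (k + n) - q n) \<le> T n" for k
    proof -
      have "coord_sum (s n) * norm (q (k + n) - q n) \<le> (\<Sum>j<k. \<eta> (j + n))"
      proof (induction k)
        case (Suc k)
        have "norm (q (Suc k + n) - q n) \<le> norm (q (Suc (k + n)) - q (k + n)) + norm (q (k + n) - q n)"
          using norm_triangle_ineq[of "q (Suc (k + n)) - q (k + n)" "q (k + n) - q n"] by simp
        then have "coord_sum (s n) * norm (q (Suc k + n) - q n) \<le>
            coord_sum (s n) * (norm (q (Suc (k + n)) - q (k + n)) + norm (q (k + n) - q n))"
          using s_pos[of n] by (intro mult_left_mono) auto
        then show ?case using Suc step[of n "k + n"] by (simp add: distrib_left)
      qed simp
      also have "\<dots> \<le> T n"
        unfolding T_def by (intro sum_le_suminf summable_ignore_initial_segment sum\<eta>) (auto simp: \<eta>_nonneg)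
      finally show ?thesis .
    qed
    then show "\<exists>N. \<forall>k\<ge>N. coord_sum (s n) * norm (q (k + n) - q n) \<le> T n" by blast
  qed
  define \<epsilon> where "\<epsilon> n = \<delta> n + T n" for n
  have M_sum_ge: "coord_sum (M (int n) *v ones) \<ge> 1" for n
    using nonneg_unimodular_row_sum_ge_1[OF M, of "int n" undefined]
      component_le_coord_sum[of "M (int n) *v ones" undefined]
      mult_vec_nonneg[OF nonneg_unimodular_entry_nonneg[OF M]] by force
  have \<delta>_nonneg: "\<delta> n \<ge> 0" for n
  proof (rule ccontr)
    assume "\<not> \<delta> n \<ge> 0"
    then have "\<eta> n < 0" using M_sum_ge[of n] by (simp add: \<eta>_def mult_less_0_iff)
    then show False using \<eta>_nonneg[of n] by simp
  qed
  have \<delta>_le: "\<delta> n \<le> \<eta> n" for n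
    using mult_left_mono[OF M_sum_ge \<delta>_nonneg, of n n] by (simp add: \<eta>_def)
  have "\<delta> \<longlonglongrightarrow> 0"
    by (rule tendsto_sandwich[OF _ _ tendsto_const summable_LIMSEQ_zero[OF sum\<eta>]])
      (auto simp: \<delta>_nonneg \<delta>_le)
  then have \<epsilon>0: "\<epsilon> \<longlonglongrightarrow> 0" unfolding \<epsilon>_def using tendsto_add[OF _ T0] by fastforce
  \<comment> \<open>There are two errors: the column against the current direction
    \<open>q n\<close>, and \<open>q n\<close> against \<open>u\<close>. The second is multiplied by
    the size of the column, at most \<open>coord_sum (s n)\<close>, which is exactly the weight in
    \<open>s_dist\<close>.\<close>
  have column_bound: "norm (A n *v axis i 1 - coord_sum (A n *v axis i 1) *\<^sub>R u) \<le> \<epsilon> n" for n i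
  proof -
    define a where "a = A n *v axis i 1"
    have "a $ k \<le> s n $ k" for k
      unfolding s_def a_def by (rule mult_vec_mono[OF A_nonneg]) (simp add: axis_def)
    then have le: "coord_sum a \<le> coord_sum (s n)" by (rule coord_sum_mono)
    have a0: "coord_sum a \<ge> 0"
      by (rule coord_sum_nonneg) (simp add: a_def mult_axis A_nonneg)
    have "norm (a - coord_sum a *\<^sub>R u) \<le> norm (a - coord_sum a *\<^sub>R q n) + norm (coord_sum a *\<^sub>R (q n - u))"
      using norm_triangle_ineq[of "a - coord_sum a *\<^sub>R q n" "coord_sum a *\<^sub>R (q n - u)"]
      by (simp add: scaleR_diff_right)
    also have "norm (a - coord_sum a *\<^sub>R q n) \<le> \<delta> n"
      using near[of "axis i 1" n] by (simp add: a_def coord_sum_def axis_def)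
    also have "norm (coord_sum a *\<^sub>R (q n - u)) \<le> coord_sum (s n) * norm (u - q n)"
      using le a0 by (simp add: mult_right_mono norm_minus_commute)
    also have "\<dots> \<le> T n" by (rule s_dist)
    finally show ?thesis by (simp add: \<epsilon>_def a_def)
  qed
  have strong: "strong_convergence_future M u"
    unfolding strong_convergence_future_def A_def[symmetric]
  proof
    fix i
    have "infdist (A n *v axis i 1) (span {u}) \<le> \<epsilon> n" for n
    proof -
      have "infdist (A n *v axis i 1) (span {u}) \<le> dist (A n *v axis i 1) (coord_sum (A n *v axis i 1) *\<^sub>R u)"
        by (intro infdist_le) (simp add: span_base span_scale)
      also have "\<dots> \<le> \<epsilon> n" unfolding dist_norm by (rule column_bound)
      finally show ?thesis .
    qed
    then show "(\<lambda>n. infdist (A n *v axis i 1) (span {u})) \<longlonglongrightarrow> 0"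
      by (intro tendsto_sandwich[OF _ _ tendsto_const \<epsilon>0]) (auto simp: infdist_nonneg)
  qed
  have cone_closed: "closed ((*v) (A n) ` nonneg_orthant)" for n
  proof (rule closed_injective_linear_image)
    show "closed (nonneg_orthant :: (real^'n) set)"
      unfolding nonneg_orthant_def
      by (intro closed_Collect_all closed_Collect_le continuous_intros)
    show "inj ((*v) (A n))"
      using nonneg_unimodular_invertible[OF AU] by (simp add: inj_matrix_vector_mult)
  qed simp
  \<comment> \<open>For \<open>k \<ge> n\<close> the product \<open>A k\<close> factors through
    \<open>A n\<close>, so \<open>t *\<^sub>R q k\<close> lies in the cone of index
    \<open>n\<close>. This cone is closed and keeps the limit.\<close>
  have u_in: "t *\<^sub>R u \<in> (*v) (A n) ` nonneg_orthant" if "t \<ge> 0" for t n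
  proof (rule Lim_in_closed_set[OF cone_closed])
    show "eventually (\<lambda>k. t *\<^sub>R q k \<in> (*v) (A n) ` nonneg_orthant) sequentially"
    proof (rule eventually_sequentiallyI)
      fix k assume "n \<le> k"
      define y where "y = (t / coord_sum (s k)) *\<^sub>R (mprod M (int n) (int k) *v ones)"
      have "y \<in> nonneg_orthant"
        using that s_pos[of k]
          mult_vec_nonneg[OF nonneg_unimodular_entry_nonneg[OF mprod_nonneg_unimodular[of M, OF M]]]
        by (simp add: y_def nonneg_orthant_def)
      moreover have "t *\<^sub>R q k = A n *v y"
        by (simp add: y_def q_def s_def A_mult[OF \<open>n \<le> k\<close>] matrix_vector_mult_scaleR
            matrix_vector_mul_assoc divide_inverse)
      ultimately show "t *\<^sub>R q k \<in> (*v) (A n) ` nonneg_orthant" by blast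
    qed
    show "(\<lambda>k. t *\<^sub>R q k) \<longlonglongrightarrow> t *\<^sub>R u" by (intro tendsto_intros u)
  qed simp
  have in_ray: "\<exists>t\<ge>0. y = t *\<^sub>R u" if y: "\<And>n. y \<in> (*v) (A n) ` nonneg_orthant" for y
  proof -
    have "A 0 = mat 1" by (simp add: A_def mprod_empty)
    then have "y $ i \<ge> 0" for i using y[of 0] by (auto simp: nonneg_orthant_def)
    then have y0: "coord_sum y \<ge> 0" by (rule coord_sum_nonneg)
    \<comment> \<open>All column sums are at least 1, so the nonnegative coefficients of
      \<open>y\<close> over the columns of \<open>A n\<close> are at most
      \<open>coord_sum y\<close>, uniformly in \<open>n\<close>. Each column is within
      \<open>\<epsilon> n\<close> of the ray, and \<open>n\<close> may tend to infinity.\<close>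
    have "norm (y - coord_sum y *\<^sub>R u) \<le> real CARD('n) * coord_sum y * \<epsilon> n" for n
    proof -
      obtain x where x: "\<And>i. x $ i \<ge> 0" "y = A n *v x"
        using y[of n] by (auto simp: nonneg_orthant_def)
      have y_eq: "y = (\<Sum>j\<in>UNIV. x $ j *\<^sub>R (A n *v axis j 1))"
        using x(2) mult_vec_eq_sum_columns by metis
      have \<phi>y: "coord_sum y = (\<Sum>j\<in>UNIV. x $ j * coord_sum (A n *v axis j 1))"
        unfolding y_eq by simp
      have x_le: "x $ j \<le> coord_sum y" for j
      proof -
        have ge1: "coord_sum (A n *v axis j 1) \<ge> 1" for j
          by (rule nonneg_unimodular_column_sum_ge_1[OF AU])
        have "x $ j \<le> x $ j * coord_sum (A n *v axis j 1)"
          using mult_left_mono[OF ge1 x(1), of j j] by simp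
        also have "\<dots> \<le> coord_sum y"
          unfolding \<phi>y
          by (rule member_le_sum) (simp_all add: mult_nonneg_nonneg[OF x(1) order_trans[OF zero_le_one ge1]])
        finally show ?thesis .
      qed
      have "y - coord_sum y *\<^sub>R u = (\<Sum>j\<in>UNIV. x $ j *\<^sub>R (A n *v axis j 1 - coord_sum (A n *v axis j 1) *\<^sub>R u))"
        by (subst y_eq, subst \<phi>y) (simp add: scaleR_diff_right sum_subtractf scaleR_sum_left)
      also have "norm \<dots> \<le> (\<Sum>j\<in>(UNIV :: 'n set). coord_sum y * \<epsilon> n)"
        using x(1) x_le y0 column_bound by (intro sum_norm_le) (simp add: mult_mono)
      finally show ?thesis by simp
    qed
    then have "norm (y - coord_sum y *\<^sub>R u) \<le> real CARD('n) * coord_sum y * 0"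
      by (intro LIMSEQ_le_const[OF tendsto_mult[OF tendsto_const \<epsilon>0]]) auto
    then show ?thesis using y0 by auto
  qed
  have "(\<Inter>n. (*v) (A n) ` nonneg_orthant) = {t *\<^sub>R u | t. t \<ge> 0}"
  proof (intro equalityI subsetI)
    fix y assume "y \<in> (\<Inter>n. (*v) (A n) ` nonneg_orthant)"
    then have "y \<in> (*v) (A n) ` nonneg_orthant" for n by (rule INT_D) simp
    from in_ray[OF this] show "y \<in> {t *\<^sub>R u | t. t \<ge> 0}" by auto
  next
    fix y assume "y \<in> {t *\<^sub>R u | t. t \<ge> 0}"
    then obtain t where "t \<ge> 0" "y = t *\<^sub>R u" by blast
    then show "y \<in> (\<Inter>n. (*v) (A n) ` nonneg_orthant)" by (intro INT_I) (simp only: u_in)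
  qed
  moreover have "u \<in> nonneg_orthant - {0}"
    using u_nonneg u_sum by (auto simp: nonneg_orthant_def)
  ultimately have "generalized_right_eigenvector M u"
    by (simp add: generalized_right_eigenvector_def A_def)
  with strong show ?thesis by blast
qed

section \<open>Summability from the Pisot and growth conditions\<close>

lemma delta2_nonneg:
  fixes A :: "real^'n^'n"
  assumes "CARD('n) \<ge> 2"
  shows "delta2 A \<ge> 0"
proof -
  obtain w a where "norm (A *v axis undefined 1 - a *\<^sub>R w) \<le> delta2 A * norm (axis undefined 1 :: real^'n)"
    using near_line_delta2[OF assms, of A] by blast
  then have "norm (A *v axis undefined 1 - a *\<^sub>R w) \<le> delta2 A" by simp
  then show ?thesis using norm_ge_zero order_trans by blast
qed

lemma local_pisot_exponential_decay:
  assumes "local_pisot M"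
  obtains c where "c > 0" "eventually (\<lambda>n. delta2 (mprod M 0 (int n)) \<le> exp (- c * real n)) sequentially"
proof -
  obtain r where r: "limsup (\<lambda>n. ereal (1 / real n * ln (delta2 (mprod M 0 (int n))))) < ereal r" "ereal r < 0"
    using assms ereal_dense2 unfolding local_pisot_def by blast
  have "eventually (\<lambda>n. delta2 (mprod M 0 (int n)) \<le> exp (- (- r) * real n)) sequentially"
    using Limsup_lessD[OF r(1)] eventually_gt_at_top[of 0]
  proof eventually_elim
    case (elim n)
    define x where "x = delta2 (mprod M 0 (int n))"
    have "ln x < r * real n" using elim by (simp add: x_def field_simps)
    then have le: "exp (ln x) \<le> exp (r * real n)" by simp
    \<comment> \<open>The logarithm is informative only for positive \<open>x\<close>; otherwise the
      bound is trivial.\<close>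
    have "x \<le> exp (r * real n)"
    proof (cases "x > 0")
      case False
      then show ?thesis using exp_gt_zero[of "r * real n"] by linarith
    qed (use le in simp)
    then show ?case by (simp add: x_def)
  qed
  moreover have "- r > 0" using r(2) by simp
  ultimately show ?thesis using that by blast
qed

text \<open>The absolute value lets one statement serve \<open>at_top\<close> and
  \<open>at_bot\<close>, where the factor \<open>1 / n\<close> has opposite signs.\<close>

lemma growth_exponential_bound:
  assumes "((\<lambda>n. 1 / real_of_int n * ln (g n)) \<longlongrightarrow> 0) F" "c > 0"
    "eventually (\<lambda>n. n \<noteq> 0) F" "\<And>n. g n > 0"
  shows "eventually (\<lambda>n. g n \<le> exp (c * \<bar>real_of_int n\<bar>)) F"
  using tendstoD[OF assms(1,2)] assms(3)
proof eventually_elim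
  case (elim n)
  then have "\<bar>ln (g n)\<bar> < c * \<bar>real_of_int n\<bar>"
    by (simp add: dist_real_def abs_mult field_simps)
  then have "exp (ln (g n)) \<le> exp (c * \<bar>real_of_int n\<bar>)" by (simp add: abs_less_iff)
  then show ?case using assms(4) by simp
qed

text \<open>Growth is measured by the sum of all entries, which transposition preserves, as an
  arbitrary norm need not. In this form the lemma serves both time directions.\<close>

lemma strong_convergence_of_local_pisot:
  fixes M :: "int \<Rightarrow> real^'n^'n"
  assumes d: "CARD('n) \<ge> 2" and M: "\<And>n. M n \<in> nonneg_unimodular" and "local_pisot M"
    and growth: "\<And>c. c > 0 \<Longrightarrow> \<exists>K. eventually (\<lambda>n. coord_sum (M (int n) *v ones) \<le> K * exp (c * real n)) sequentially"
  shows "\<exists>u. generalized_right_eigenvector M u \<and> strong_convergence_future M u"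
proof (rule strong_convergence_of_summable[OF d M])
  obtain c where c: "c > 0" "eventually (\<lambda>n. delta2 (mprod M 0 (int n)) \<le> exp (- c * real n)) sequentially"
    using local_pisot_exponential_decay[OF assms(3)] by blast
  \<comment> \<open>Half of the decay rate is spent on the growth of \<open>M\<close>; the other
    half leaves a geometric majorant.\<close>
  obtain K where K: "eventually (\<lambda>n. coord_sum (M (int n) *v ones) \<le> K * exp (c / 2 * real n)) sequentially"
    using growth[of "c / 2"] c(1) by auto
  have sum_nonneg: "coord_sum (M (int n) *v ones) \<ge> 0" for n
    by (intro coord_sum_nonneg mult_vec_nonneg nonneg_unimodular_entry_nonneg M) simp
  show "summable (\<lambda>n. delta2 (mprod M 0 (int n)) * coord_sum (M (int n) *v ones))"
  proof (rule summable_comparison_test_ev)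
    show "eventually (\<lambda>n. norm (delta2 (mprod M 0 (int n)) * coord_sum (M (int n) *v ones))
        \<le> K * exp (- c / 2) ^ n) sequentially"
      using c(2) K
    proof eventually_elim
      case (elim n)
      have "delta2 (mprod M 0 (int n)) * coord_sum (M (int n) *v ones)
          \<le> exp (- c * real n) * (K * exp (c / 2 * real n))"
        by (intro mult_mono elim sum_nonneg) simp
      also have "\<dots> = K * exp (- c / 2 * real n)"
        by (simp add: mult.left_commute flip: exp_add)
      also have "\<dots> = K * exp (- c / 2) ^ n"
        by (simp only: exp_of_nat2_mult)
      finally show ?case using delta2_nonneg[OF d] sum_nonneg by simp
    qed
    show "summable (\<lambda>n. K * exp (- c / 2) ^ n)"
      using c(1) by (intro summable_mult summable_geometric) simp
  qed
qed

lemma coord_sum_row_sums_le: "coord_sum (A *v ones) \<le> (real CARD('n))\<^sup>2 * norm (A :: real^'n^'n)"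
proof -
  have "A $ i $ j \<le> norm A" for i j
    using Finite_Cartesian_Product.norm_nth_le[of A i] component_le_norm_cart[of "A $ i" j] by linarith
  then have "(\<Sum>i\<in>UNIV. \<Sum>j\<in>UNIV. A $ i $ j) \<le> (\<Sum>i\<in>(UNIV :: 'n set). \<Sum>j\<in>(UNIV :: 'n set). norm A)"
    by (intro sum_mono)
  then show ?thesis by (simp add: coord_sum_def matrix_vector_mult_def power2_eq_square)
qed

lemma coord_sum_row_sums_transpose: "coord_sum (transpose A *v ones) = coord_sum (A *v ones)"
  unfolding coord_sum_def matrix_vector_mult_def
  by (simp add: transpose_def) (rule sum.swap)

text \<open>Norm equivalence bounds the sum of the entries by a multiple of \<open>N\<close>, and
  the factor disappears in \<open>K\<close>. The filter is left open to cover both ends of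
  time.\<close>

lemma row_sums_growth:
  fixes M :: "int \<Rightarrow> real^'n^'n"
  assumes M: "\<And>n. M n \<in> nonneg_unimodular" and N: "is_norm N"
    and lim: "((\<lambda>n. 1 / real_of_int n * ln (N (M n))) \<longlongrightarrow> 0) F" and nz: "eventually (\<lambda>n. n \<noteq> 0) F"
    and c: "c > 0"
  shows "\<exists>K. eventually (\<lambda>n. coord_sum (M n *v ones) \<le> K * exp (c * \<bar>real_of_int n\<bar>)) F"
proof -
  obtain a b where a: "a > 0" and "b > 0" and a_le: "\<And>x. a * norm x \<le> N x" and "\<And>x. N x \<le> b * norm x"
    by (rule is_norm_equivalent[OF N]) (rule that)
  have "N (M n) > 0" for n
  proof -
    obtain i where "M n $ i $ undefined \<ge> 1"
      using nonneg_unimodular_column_ge_1[OF M[of n], of undefined] by blast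
    then have "M n \<noteq> 0" by (metis not_one_le_zero zero_index)
    then have "0 < a * norm (M n)" using a by simp
    then show ?thesis using a_le[of "M n"] by linarith
  qed
  from growth_exponential_bound[OF lim c nz this]
  have "eventually (\<lambda>n. coord_sum (M n *v ones) \<le> ((real CARD('n))\<^sup>2 / a) * exp (c * \<bar>real_of_int n\<bar>)) F"
  proof eventually_elim
    case (elim n)
    have "norm (M n) \<le> N (M n) / a" using a_le[of "M n"] a by (simp add: field_simps)
    also have "\<dots> \<le> exp (c * \<bar>real_of_int n\<bar>) / a" using elim a by (simp add: divide_right_mono)
    finally have "(real CARD('n))\<^sup>2 * norm (M n) \<le> (real CARD('n))\<^sup>2 * (exp (c * \<bar>real_of_int n\<bar>) / a)"
      by (intro mult_left_mono) auto
    then show ?case using coord_sum_row_sums_le[of "M n"] by simp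
  qed
  then show ?thesis by (rule exI)
qed

lemma strong_convergence_future_and_past:
  fixes M :: "int \<Rightarrow> real^'n^'n"
  assumes d: "CARD('n) \<ge> 2" and M: "\<And>n. M n \<in> nonneg_unimodular"
    and pisot: "two_sided_local_pisot M" and N: "is_norm N" and growth: "growth_condition N M"
  shows "\<exists>u. generalized_right_eigenvector M u \<and> strong_convergence_future M u" (is ?future)
    and "\<exists>v. generalized_left_eigenvector M v \<and> strong_convergence_past M v" (is ?past)
proof -
  show ?future
  proof (rule strong_convergence_of_local_pisot[OF d M])
    show "local_pisot M" using pisot by (simp add: two_sided_local_pisot_def)
    fix c :: real assume c: "c > 0"
    have "((\<lambda>n. 1 / real_of_int n * ln (N (M n))) \<longlongrightarrow> 0) at_top"
      using growth by (simp add: growth_condition_def)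
    from row_sums_growth[OF M N this _ c]
    obtain K where "eventually (\<lambda>n. coord_sum (M n *v ones) \<le> K * exp (c * \<bar>real_of_int n\<bar>)) at_top"
      using eventually_gt_at_top[of "0 :: int"] by (auto elim: eventually_mono)
    from eventually_compose_filterlim[OF this filterlim_int_sequentially]
    show "\<exists>K. eventually (\<lambda>n. coord_sum (M (int n) *v ones) \<le> K * exp (c * real n)) sequentially"
      by auto
  qed
  define M' where "M' n = transpose (M (- n - 1))" for n
  have M': "M' n \<in> nonneg_unimodular" for n
    by (simp add: M'_def nonneg_unimodular_transpose M)
  have "\<exists>u. generalized_right_eigenvector M' u \<and> strong_convergence_future M' u"
  proof (rule strong_convergence_of_local_pisot[OF d M'])
    show "local_pisot M'" using pisot by (simp add: two_sided_local_pisot_def M'_def[abs_def])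
    fix c :: real assume c: "c > 0"
    have "((\<lambda>n. 1 / real_of_int n * ln (N (M n))) \<longlongrightarrow> 0) at_bot"
      using growth by (simp add: growth_condition_def)
    from row_sums_growth[OF M N this _ c]
    obtain K where "eventually (\<lambda>n. coord_sum (M n *v ones) \<le> K * exp (c * \<bar>real_of_int n\<bar>)) at_bot"
      using eventually_gt_at_bot[of "0 :: int"] by (auto elim: eventually_mono)
    moreover have "filterlim (\<lambda>n. - int n - 1) at_bot sequentially"
      unfolding filterlim_at_bot
    proof
      fix z
      show "eventually (\<lambda>n. - int n - 1 \<le> z) sequentially"
        using eventually_ge_at_top[of "nat (- z)"] by eventually_elim linarith
    qed
    ultimately have "eventually (\<lambda>n. coord_sum (M (- int n - 1) *v ones)
        \<le> K * exp (c * \<bar>real_of_int (- int n - 1)\<bar>)) sequentially"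
      by (rule eventually_compose_filterlim)
    \<comment> \<open>The index \<open>- n - 1\<close> has absolute value \<open>n + 1\<close>,
      which costs the constant factor \<open>exp c\<close>.\<close>
    then have "eventually (\<lambda>n. coord_sum (M' (int n) *v ones) \<le> K * exp c * exp (c * real n)) sequentially"
    proof eventually_elim
      case (elim n)
      have "\<bar>real_of_int (- int n - 1)\<bar> = 1 + real n" by simp
      with elim show ?case
        by (simp only: M'_def coord_sum_row_sums_transpose) (simp add: distrib_left exp_add mult.assoc)
    qed
    then show "\<exists>K. eventually (\<lambda>n. coord_sum (M' (int n) *v ones) \<le> K * exp (c * real n)) sequentially"
      by blast
  qed
  moreover have "mprod M' 0 (int n) = transpose (mprod M (- int n) 0)" for n
    using mprod_transpose_reversed[of M 0 "int n"] by (simp add: M'_def[abs_def])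
  ultimately show ?past
    by (simp add: generalized_right_eigenvector_def generalized_left_eigenvector_def
        strong_convergence_future_def strong_convergence_past_def)
qed

section \<open>The invariant splitting\<close>

lemma mult_matrix_inv_vec:
  fixes A :: "real^'n^'n"
  assumes "invertible A"
  shows "A *v (matrix_inv A *v x) = x" "matrix_inv A *v (A *v x) = x"
  using matrix_inv_mult[OF assms] by (simp_all add: matrix_vector_mul_assoc)

lemma inner_transpose_mult: "(A *v x) \<bullet> y = x \<bullet> (transpose A *v (y :: real^'n))"
  by (metis dot_lmul_matrix inner_commute transpose_matrix_vector)

lemma infdist_span_attained:
  fixes u :: "'a::euclidean_space"
  shows "\<exists>t. infdist x (span {u}) = norm (x - t *\<^sub>R u)"
proof -
  obtain y where "y \<in> span {u}" "infdist x (span {u}) = dist x y"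
    using infdist_attains_inf[OF closed_span, of "{u}" x] span_zero by blast
  then show ?thesis by (auto simp: span_singleton dist_norm)
qed

lemma positive_product_of_primitive:
  assumes "two_sided_primitive M"
  shows "\<exists>n>m. \<forall>i j. mprod M m n $ i $ j > 0" "\<exists>m<n. \<forall>i j. mprod M m n $ i $ j > 0"
  using assms by (auto simp: two_sided_primitive_def)

lemma positive_mult_nonneg:
  fixes A :: "real^'n^'m"
  assumes A: "\<And>i j. A $ i $ j > 0" and x: "\<And>i. x $ i \<ge> 0" "x \<noteq> 0"
  shows "(A *v x) $ i > 0"
proof -
  obtain j where "x $ j \<noteq> 0" using x(2) by (auto simp: vec_eq_iff)
  then have "0 < A $ i $ j * x $ j" using A[of i j] x(1)[of j] by simp
  also have "\<dots> \<le> (\<Sum>j\<in>UNIV. A $ i $ j * x $ j)"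
    using less_imp_le[OF A] x(1) by (intro member_le_sum) auto
  finally show ?thesis by (simp add: matrix_vector_mult_def)
qed

text \<open>A block with positive integer entries maps a column of the remaining product, whose sum
  is at least 1, to a vector \<open>y\<close> with all coordinates at least 1. Each earlier column,
  of sum at least \<open>2 ^ j\<close>, is then counted at least once, and there are
  \<open>CARD('n) \<ge> 2\<close> of them. The trailing factor \<open>mprod M n k\<close> is
  arbitrary, so the bound persists for all later \<open>k\<close>.\<close>

lemma column_sums_tend_to_infinity:
  fixes M :: "int \<Rightarrow> real^'n^'n"
  assumes d: "CARD('n) \<ge> 2" and M: "\<And>n. M n \<in> nonneg_unimodular"
    and prim: "\<And>m. \<exists>n>m. \<forall>i j. mprod M m n $ i $ j > 0"
  shows "\<exists>K\<ge>m. \<forall>k\<ge>K. \<forall>i. coord_sum (mprod M m k *v axis i 1) \<ge> 2 ^ j"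
proof (induction j)
  case 0
  show ?case
    using nonneg_unimodular_column_sum_ge_1[OF mprod_nonneg_unimodular[of M, OF M]]
    by (intro exI[of _ m]) simp
next
  case (Suc j)
  then obtain K where K: "K \<ge> m" "\<And>i. coord_sum (mprod M m K *v axis i 1) \<ge> 2 ^ j" by blast
  obtain n where n: "n > K" "\<And>i j. mprod M K n $ i $ j > 0" using prim by blast
  note PU = mprod_nonneg_unimodular[of M, OF M]
  note P_nonneg = nonneg_unimodular_entry_nonneg[OF PU]
  have "coord_sum (mprod M m k *v axis i 1) \<ge> 2 ^ Suc j" if k: "k \<ge> n" for k i
  proof -
    define z where "z = mprod M n k *v axis i 1"
    define y where "y = mprod M K n *v z"
    have z: "z $ l \<ge> 0" for l by (simp add: z_def mult_axis P_nonneg)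
    have entry: "mprod M K n $ l $ h \<ge> 1" for l h
    proof -
      have "mprod M K n $ l $ h \<in> \<nat>" using PU by (simp add: nonneg_unimodular_def)
      then obtain a :: nat where "mprod M K n $ l $ h = real a" by (auto elim: Nats_cases)
      then show ?thesis using n(2)[of l h] by simp
    qed
    have y: "y $ l \<ge> 1" for l
    proof -
      have "1 \<le> coord_sum z" unfolding z_def by (rule nonneg_unimodular_column_sum_ge_1[OF PU])
      also have "\<dots> \<le> y $ l"
        unfolding y_def coord_sum_def matrix_vector_mult_def
        using mult_right_mono[OF entry z] by (auto intro!: sum_mono)
      finally show ?thesis .
    qed
    have "mprod M m k = mprod M m K ** mprod M K n ** mprod M n k"
      using K(1) n(1) k by (simp add: mprod_mult)
    then have "mprod M m k *v axis i 1 = mprod M m K *v y"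
      by (simp add: y_def z_def matrix_vector_mul_assoc matrix_mul_assoc)
    also have "coord_sum \<dots> = (\<Sum>l\<in>UNIV. y $ l * coord_sum (mprod M m K *v axis l 1))"
      by (subst mult_vec_eq_sum_columns) simp
    also have "\<dots> \<ge> (\<Sum>l\<in>(UNIV :: 'n set). 1 * 2 ^ j)"
      using y K(2) order_trans[OF zero_le_one y] by (intro sum_mono mult_mono) auto
    finally have "real CARD('n) * 2 ^ j \<le> coord_sum (mprod M m k *v axis i 1)" by simp
    moreover have "(2 :: real) ^ Suc j \<le> real CARD('n) * 2 ^ j" using d by simp
    ultimately show ?thesis by linarith
  qed
  then show ?case using K(1) n(1) by (intro exI[of _ n]) auto
qed

text \<open>Strong convergence stands in for the Pisot and growth conditions from here on. Fixing
  \<open>u\<close> and \<open>v\<close> makes both families of vectors functions of the time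
  alone.\<close>

locale strongly_convergent =
  fixes M :: "int \<Rightarrow> real^'n^'n" and u v :: "real^'n"
  assumes two_le_card: "CARD('n) \<ge> 2"
    and M: "\<And>n. M n \<in> nonneg_unimodular"
    and primitive: "two_sided_primitive M"
    and right: "generalized_right_eigenvector M u" and future: "strong_convergence_future M u"
    and left: "generalized_left_eigenvector M v" and past: "strong_convergence_past M v"
begin

abbreviation P where "P \<equiv> mprod M"
abbreviation U where "U \<equiv> right_vec M u"
abbreviation V where "V \<equiv> left_vec M v"

lemma P_unimodular: "P m n \<in> nonneg_unimodular"
  by (rule mprod_nonneg_unimodular[OF M])

lemma P_invertible: "invertible (P m n)"
  by (rule nonneg_unimodular_invertible[OF P_unimodular])

lemma P_nonneg: "P m n $ i $ j \<ge> 0"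
  by (rule nonneg_unimodular_entry_nonneg[OF P_unimodular])

lemma P_inj: "P m n *v x = P m n *v y \<Longrightarrow> x = y"
  using inj_matrix_vector_mult[OF P_invertible] by (auto dest: injD)

lemma P_mult_vec: "a \<le> b \<Longrightarrow> b \<le> c \<Longrightarrow> P a b *v (P b c *v x) = P a c *v x"
  by (simp add: matrix_vector_mul_assoc mprod_mult)

lemma u_preimage_nonneg: "\<exists>x. (\<forall>i. x $ i \<ge> 0) \<and> P 0 (int n) *v x = u"
proof -
  have "u \<in> {t *\<^sub>R u | t. t \<ge> 0}" by (auto intro: exI[of _ 1])
  then have "u \<in> (\<Inter>n::nat. (*v) (P 0 (int n)) ` nonneg_orthant)"
    using right by (simp only: generalized_right_eigenvector_def)
  then have "u \<in> (*v) (P 0 (int n)) ` nonneg_orthant" by (rule INT_D) simp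
  then show ?thesis by (auto simp: nonneg_orthant_def)
qed

lemma v_preimage_nonneg: "\<exists>x. (\<forall>i. x $ i \<ge> 0) \<and> transpose (P (- int n) 0) *v x = v"
proof -
  have "v \<in> {t *\<^sub>R v | t. t \<ge> 0}" by (auto intro: exI[of _ 1])
  then have "v \<in> (\<Inter>n::nat. (*v) (transpose (P (- int n) 0)) ` nonneg_orthant)"
    using left by (simp only: generalized_left_eigenvector_def)
  then have "v \<in> (*v) (transpose (P (- int n) 0)) ` nonneg_orthant" by (rule INT_D) simp
  then show ?thesis unfolding nonneg_orthant_def by blast
qed

lemma u_nonzero: "u \<noteq> 0"
  using right by (simp add: generalized_right_eigenvector_def)

lemma v_nonzero: "v \<noteq> 0"
  using left by (simp add: generalized_left_eigenvector_def)

text \<open>\<open>u\<close> is the image of a nonzero nonnegative vector under a block with all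
  entries positive.\<close>

lemma u_pos: "u $ i > 0"
proof -
  obtain n where n: "n > 0" "\<And>i j. P 0 n $ i $ j > 0"
    using positive_product_of_primitive(1)[OF primitive, of 0] by blast
  obtain x where x: "\<And>i. x $ i \<ge> 0" "P 0 (int (nat n)) *v x = u" using u_preimage_nonneg by blast
  have "x \<noteq> 0" using x(2) u_nonzero by auto
  then show ?thesis
    using positive_mult_nonneg[of "P 0 n" x i] n x by simp
qed

lemma v_pos: "v $ i > 0"
proof -
  obtain m where m: "m < 0" "\<And>i j. P m 0 $ i $ j > 0"
    using positive_product_of_primitive(2)[OF primitive, of 0] by blast
  obtain x where x: "\<And>i. x $ i \<ge> 0" "transpose (P (- int (nat (- m))) 0) *v x = v"
    using v_preimage_nonneg by blast
  have "x \<noteq> 0" using x(2) v_nonzero by auto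
  moreover have "transpose (P m 0) $ i $ j > 0" for i j using m(2) by (simp add: transpose_def)
  moreover have "- int (nat (- m)) = m" using m(1) by simp
  ultimately show ?thesis
    using positive_mult_nonneg[of "transpose (P m 0)" x i] x by metis
qed

lemma inner_uv_pos: "u \<bullet> v > 0"
  unfolding inner_vec_def using u_pos v_pos by (intro sum_pos) auto

text \<open>The two cases of \<open>right_vec\<close> amount to one cocycle relation. For
  \<open>0 \<le> m\<close> it is checked after applying the injective \<open>P 0 m\<close>; a
  product across time 0 is split there.\<close>

lemma P_U: "m \<le> n \<Longrightarrow> P m n *v U n = U m"
proof -
  have nonneg: "P 0 n *v U n = u" if "n \<ge> 0" for n
    using that by (simp add: right_vec_def mult_matrix_inv_vec[OF P_invertible])
  have neg: "U n = P n 0 *v u" if "n \<le> 0" for n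
  proof (cases "n = 0")
    case True
    then show ?thesis using nonneg[of 0] by (simp add: mprod_empty)
  qed (use that in \<open>simp add: right_vec_def\<close>)
  assume "m \<le> n"
  consider "0 \<le> m" | "m < 0" "0 \<le> n" | "n < 0" by linarith
  then show ?thesis
  proof cases
    case 1
    then have "P 0 m *v (P m n *v U n) = P 0 m *v U m"
      using \<open>m \<le> n\<close> by (simp add: P_mult_vec nonneg)
    then show ?thesis by (rule P_inj)
  next
    case 2
    then have "P m n *v U n = P m 0 *v (P 0 n *v U n)" by (simp add: P_mult_vec)
    with 2 show ?thesis by (simp add: nonneg neg)
  next
    case 3
    then show ?thesis using \<open>m \<le> n\<close> by (simp add: neg P_mult_vec)
  qed
qed

lemma PT_V: "m \<le> n \<Longrightarrow> transpose (P m n) *v V m = V n"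
proof -
  have T_mult: "transpose (P b c) *v (transpose (P a b) *v x) = transpose (P a c) *v x"
    if "a \<le> b" "b \<le> c" for a b c x
    using that by (simp add: matrix_vector_mul_assoc mprod_mult flip: matrix_transpose_mul
        del: transpose_matrix_vector)
  have inv: "invertible (transpose (P m n))" for m n
    by (rule nonneg_unimodular_invertible[OF nonneg_unimodular_transpose[OF P_unimodular]])
  have T_inj: "x = y" if "transpose (P m n) *v x = transpose (P m n) *v y" for m n x y
    using inj_matrix_vector_mult[OF inv] that by (rule injD)
  have nonneg: "V n = transpose (P 0 n) *v v" if "n \<ge> 0" for n
    using that by (simp add: left_vec_def)
  have neg: "transpose (P n 0) *v V n = v" if "n \<le> 0" for n
  proof (cases "n = 0")
    case True
    then show ?thesis using nonneg[of 0] by (simp add: mprod_empty transpose_mat)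
  next
    case False
    then show ?thesis using that mult_matrix_inv_vec(1)[OF inv, of n 0 v] by (simp add: left_vec_def)
  qed
  assume "m \<le> n"
  consider "0 \<le> m" | "m < 0" "0 \<le> n" | "n < 0" by linarith
  then show ?thesis
  proof cases
    case 1
    then show ?thesis using \<open>m \<le> n\<close> by (simp add: nonneg T_mult del: transpose_matrix_vector)
  next
    case 2
    then have "transpose (P m n) *v V m = transpose (P 0 n) *v (transpose (P m 0) *v V m)"
      by (simp add: T_mult del: transpose_matrix_vector)
    with 2 show ?thesis by (simp add: nonneg neg del: transpose_matrix_vector)
  next
    case 3
    then have "transpose (P n 0) *v (transpose (P m n) *v V m) = transpose (P n 0) *v V n"
      using \<open>m \<le> n\<close> by (simp add: T_mult neg del: transpose_matrix_vector)
    then show ?thesis by (rule T_inj)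
  qed
qed

text \<open>Adjointness gives both the invariance of the hyperplanes and the constancy of the
  pairing \<open>U n \<bullet> V n\<close>.\<close>

lemma inner_P_V: "m \<le> n \<Longrightarrow> (P m n *v x) \<bullet> V m = x \<bullet> V n"
  by (simp add: inner_transpose_mult PT_V del: transpose_matrix_vector)

lemma V_0: "V 0 = v"
  by (simp add: left_vec_def mprod_empty transpose_mat)

lemma U_0: "U 0 = u"
  using mult_matrix_inv_vec(1)[OF P_invertible[of 0 0], of u]
  by (simp add: right_vec_def mprod_empty)

text \<open>Together with \<open>u \<bullet> v > 0\<close> this makes \<open>U n\<close> transversal
  to the hyperplane at every time, so that the sum is direct.\<close>

lemma inner_UV: "U n \<bullet> V n = u \<bullet> v"
proof (cases "n \<ge> 0")
  case True
  then show ?thesis using inner_P_V[of 0 n "U n"] P_U[of 0 n] by (simp add: V_0 U_0)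
next
  case False
  then show ?thesis using inner_P_V[of n 0 u] P_U[of n 0] by (simp add: V_0 U_0)
qed

lemma U_nonneg: "U n $ i \<ge> 0"
proof (cases "n \<ge> 0")
  case True
  obtain x where x: "\<And>i. x $ i \<ge> 0" "P 0 (int (nat n)) *v x = u" using u_preimage_nonneg by blast
  then have "P 0 n *v x = P 0 n *v U n" using True P_U[of 0 n] by (simp add: U_0)
  then show ?thesis using x(1) P_inj by metis
next
  case False
  then have "U n = P n 0 *v u" using P_U[of n 0] by (simp add: U_0)
  then show ?thesis using mult_vec_nonneg[OF P_nonneg] less_imp_le[OF u_pos] by metis
qed

lemma U_nonzero: "U n \<noteq> 0"
  using inner_UV[of n] inner_uv_pos by auto

lemma splitting: "invariant_splitting M (\<lambda>n. span {U n}) (\<lambda>n. orthogonal_comp {V n})"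
  unfolding invariant_splitting_def
proof (intro allI conjI)
  fix n
  have M_eq: "M n = P n (n + 1)" by (simp add: mprod_single)
  have inv: "invertible (M n)" unfolding M_eq by (rule P_invertible)
  have Gu: "x \<in> orthogonal_comp {V n} \<longleftrightarrow> x \<bullet> V n = 0" for x n
    by (auto simp: orthogonal_comp_def orthogonal_def inner_commute)
  have UV: "U n \<bullet> V n \<noteq> 0" using inner_UV inner_uv_pos by simp
  show "subspace (span {U n})" "subspace (orthogonal_comp {V n})"
    by (simp_all add: subspace_span subspace_orthogonal_comp)
  show "span {U n} \<inter> orthogonal_comp {V n} = {0}"
    using UV by (auto simp: span_singleton Gu)
  show "{x + y | x y. x \<in> span {U n} \<and> y \<in> orthogonal_comp {V n}} = UNIV"
  proof (intro equalityI subset_UNIV subsetI)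
    fix z
    \<comment> \<open>\<open>t *\<^sub>R U n\<close> is the projection of \<open>z\<close> to the
      line of \<open>U n\<close> along the hyperplane orthogonal to \<open>V n\<close>.\<close>
    define t where "t = (z \<bullet> V n) / (U n \<bullet> V n)"
    have "z = t *\<^sub>R U n + (z - t *\<^sub>R U n)" by simp
    moreover have "t *\<^sub>R U n \<in> span {U n}" by (simp add: span_base span_scale)
    moreover have "z - t *\<^sub>R U n \<in> orthogonal_comp {V n}"
      using UV by (simp add: Gu inner_diff_left t_def)
    ultimately show "z \<in> {x + y | x y. x \<in> span {U n} \<and> y \<in> orthogonal_comp {V n}}" by blast
  qed
  have "M n *v U (n + 1) = U n" using P_U[of n "n + 1"] by (simp add: M_eq)
  then have "matrix_inv (M n) *v U n = U (n + 1)" using mult_matrix_inv_vec(2)[OF inv] by metis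
  then show "(*v) (matrix_inv (M n)) ` span {U n} = span {U (n + 1)}"
    using linear_span_image[OF matrix_vector_mul_linear, of "matrix_inv (M n)" "{U n}"] by simp
  show "(*v) (matrix_inv (M n)) ` orthogonal_comp {V n} = orthogonal_comp {V (n + 1)}"
  proof (intro equalityI subsetI)
    fix y assume "y \<in> (*v) (matrix_inv (M n)) ` orthogonal_comp {V n}"
    then obtain x where x: "x \<bullet> V n = 0" "y = matrix_inv (M n) *v x" by (auto simp: Gu)
    then have "(M n *v y) \<bullet> V n = 0" by (simp add: mult_matrix_inv_vec[OF inv])
    then show "y \<in> orthogonal_comp {V (n + 1)}" by (simp add: Gu M_eq inner_P_V)
  next
    fix y assume "y \<in> orthogonal_comp {V (n + 1)}"
    then have "(M n *v y) \<bullet> V n = 0" by (simp add: Gu M_eq inner_P_V)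
    then have "M n *v y \<in> orthogonal_comp {V n}" by (simp add: Gu)
    moreover have "y = matrix_inv (M n) *v (M n *v y)" by (simp add: mult_matrix_inv_vec[OF inv])
    ultimately show "y \<in> (*v) (matrix_inv (M n)) ` orthogonal_comp {V n}" by (rule rev_image_eqI)
  qed
qed

end

section \<open>Contraction and expansion\<close>

text \<open>Multiples of \<open>v\<close> can be subtracted from \<open>a\<close> without changing
  its pairing with \<open>z\<close>.\<close>

lemma abs_inner_le_infdist:
  fixes z v :: "'a::euclidean_space"
  assumes "z \<bullet> v = 0"
  shows "\<bar>z \<bullet> a\<bar> \<le> norm z * infdist a (span {v})"
proof -
  obtain t where t: "infdist a (span {v}) = norm (a - t *\<^sub>R v)"
    using infdist_span_attained by blast
  have "z \<bullet> a = z \<bullet> (a - t *\<^sub>R v)" using assms by (simp add: inner_diff_right)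
  then show ?thesis using Cauchy_Schwarz_ineq2[of z "a - t *\<^sub>R v"] t by simp
qed

lemma matrix_bound: "\<exists>L>0. \<forall>x. norm ((B :: real^'n^'m) *v x) \<le> L * norm x"
  using bounded_linear.pos_bounded[OF matrix_vector_mul_bounded_linear[of B]]
  by (auto simp: mult.commute)

context strongly_convergent
begin

text \<open>A coordinate of \<open>P k 0 *v z\<close> is the pairing of \<open>z\<close> with a
  column of the transposed product. Strong convergence in the past brings this column close to the
  line of \<open>v\<close>, to which \<open>z\<close> is orthogonal.\<close>

lemma past_contraction_0:
  assumes "\<epsilon> > 0"
  shows "eventually (\<lambda>k. \<forall>z. z \<bullet> v = 0 \<longrightarrow> norm (P k 0 *v z) \<le> \<epsilon> * norm z) at_bot"
proof -
  define \<sigma> where "\<sigma> n = (\<Sum>i\<in>UNIV. infdist (transpose (P (- int n) 0) *v axis i 1) (span {v}))" for n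
  have "\<sigma> \<longlonglongrightarrow> (\<Sum>i\<in>(UNIV :: 'n set). 0)"
    unfolding \<sigma>_def using past unfolding strong_convergence_past_def by (intro tendsto_sum) blast
  then have "\<sigma> \<longlonglongrightarrow> 0" by simp
  then have "eventually (\<lambda>n. \<sigma> n < \<epsilon>) sequentially" using assms by (rule order_tendstoD)
  then obtain n0 where n0: "\<And>n. n \<ge> n0 \<Longrightarrow> \<sigma> n < \<epsilon>" by (auto simp: eventually_sequentially)
  show ?thesis
    unfolding eventually_at_bot_linorder
  proof (intro exI[of _ "- int n0"] allI impI)
    fix k z assume k: "k \<le> - int n0" and z: "z \<bullet> v = 0"
    have k_eq: "k = - int (nat (- k))" using k by simp
    have "norm (P k 0 *v z) \<le> (\<Sum>i\<in>UNIV. \<bar>(P k 0 *v z) $ i\<bar>)" by (rule norm_le_l1_cart)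
    also have "\<dots> = (\<Sum>i\<in>UNIV. \<bar>z \<bullet> (transpose (P k 0) *v axis i 1)\<bar>)"
      by (simp add: inner_transpose_mult[symmetric] cart_eq_inner_axis del: transpose_matrix_vector)
    also have "\<dots> \<le> (\<Sum>i\<in>UNIV. norm z * infdist (transpose (P k 0) *v axis i 1) (span {v}))"
      by (intro sum_mono abs_inner_le_infdist z)
    also have "\<dots> = norm z * \<sigma> (nat (- k))"
      using k_eq by (simp add: \<sigma>_def sum_distrib_left)
    also have "\<dots> \<le> norm z * \<epsilon>"
    proof (rule mult_left_mono)
      have "n0 \<le> nat (- k)" using k by linarith
      then show "\<sigma> (nat (- k)) \<le> \<epsilon>" by (rule less_imp_le[OF n0])
    qed simp
    finally show "norm (P k 0 *v z) \<le> \<epsilon> * norm z" by (simp add: mult.commute)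
  qed
qed

text \<open>If \<open>P 0 k *v y\<close> is close to \<open>t *\<^sub>R u\<close> and orthogonal to \<open>v\<close>, then \<open>t\<close> is small because
  \<open>u \<bullet> v > 0\<close>.\<close>

lemma future_contraction_0:
  assumes "\<epsilon> > 0"
  shows "eventually (\<lambda>k. \<forall>y. (P 0 k *v y) \<bullet> v = 0 \<longrightarrow> norm (P 0 k *v y) \<le> \<epsilon> * norm y) at_top"
proof -
  \<comment> \<open>The 1 accounts for the error \<open>\<rho>\<close> itself. The quotient bounds
    the component along \<open>u\<close>, which orthogonality to \<open>v\<close> forces to balance
    \<open>\<rho> \<bullet> v\<close>.\<close>
  define c where "c = 1 + norm u * norm v / (u \<bullet> v)"
  have c: "c > 0" using inner_uv_pos by (simp add: c_def add_pos_nonneg)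
  define \<sigma> where "\<sigma> n = (\<Sum>i\<in>UNIV. infdist (P 0 (int n) *v axis i 1) (span {u}))" for n
  have "\<sigma> \<longlonglongrightarrow> (\<Sum>i\<in>(UNIV :: 'n set). 0)"
    unfolding \<sigma>_def using future unfolding strong_convergence_future_def by (intro tendsto_sum) blast
  then have "\<sigma> \<longlonglongrightarrow> 0" by simp
  moreover have "\<epsilon> / c > 0" using assms c by simp
  ultimately have "eventually (\<lambda>n. \<sigma> n < \<epsilon> / c) sequentially" by (rule order_tendstoD)
  then obtain n0 where n0: "\<And>n. n \<ge> n0 \<Longrightarrow> \<sigma> n < \<epsilon> / c" by (auto simp: eventually_sequentially)
  show ?thesis
    unfolding eventually_at_top_linorder
  proof (intro exI[of _ "int n0"] allI impI)
    fix k y assume k: "k \<ge> int n0" and orth: "(P 0 k *v y) \<bullet> v = 0"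
    have k_eq: "int (nat k) = k" using k by simp
    define a where "a i = P 0 k *v axis i 1" for i
    have "\<forall>i. \<exists>t. infdist (a i) (span {u}) = norm (a i - t *\<^sub>R u)"
      using infdist_span_attained by blast
    then obtain t where t: "\<And>i. infdist (a i) (span {u}) = norm (a i - t i *\<^sub>R u)" by metis
    define s where "s = (\<Sum>i\<in>UNIV. y $ i * t i)"
    define \<rho> where "\<rho> = P 0 k *v y - s *\<^sub>R u"
    have "\<rho> = (\<Sum>i\<in>UNIV. y $ i *\<^sub>R (a i - t i *\<^sub>R u))"
      unfolding \<rho>_def s_def mult_vec_eq_sum_columns[of "P 0 k" y] a_def
      by (simp add: scaleR_diff_right sum_subtractf scaleR_sum_left)
    also have "norm \<dots> \<le> (\<Sum>i\<in>UNIV. norm y * infdist (a i) (span {u}))"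
      by (intro sum_norm_le) (simp add: t mult_right_mono component_le_norm_cart)
    also have "\<dots> = norm y * \<sigma> (nat k)" by (simp add: \<sigma>_def k_eq a_def sum_distrib_left del: int_nat_eq)
    also have "\<dots> \<le> norm y * (\<epsilon> / c)"
    proof (rule mult_left_mono)
      have "n0 \<le> nat k" using k by linarith
      then show "\<sigma> (nat k) \<le> \<epsilon> / c" by (rule less_imp_le[OF n0])
    qed simp
    finally have \<rho>: "norm \<rho> \<le> norm y * (\<epsilon> / c)" .
    have "s * (u \<bullet> v) = - (\<rho> \<bullet> v)" using orth by (simp add: \<rho>_def inner_diff_left)
    then have "\<bar>s\<bar> * (u \<bullet> v) = \<bar>\<rho> \<bullet> v\<bar>" using inner_uv_pos by (metis abs_minus_cancel abs_mult abs_of_pos)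
    also have "\<dots> \<le> norm \<rho> * norm v" by (rule Cauchy_Schwarz_ineq2)
    finally have "\<bar>s\<bar> \<le> norm \<rho> * norm v / (u \<bullet> v)" using inner_uv_pos by (simp add: field_simps)
    then have "\<bar>s\<bar> * norm u \<le> norm \<rho> * norm v / (u \<bullet> v) * norm u" by (rule mult_right_mono) simp
    moreover have "norm (P 0 k *v y) \<le> norm \<rho> + \<bar>s\<bar> * norm u"
      using norm_triangle_ineq[of \<rho> "s *\<^sub>R u"] by (simp add: \<rho>_def)
    ultimately have "norm (P 0 k *v y) \<le> norm \<rho> * c" by (simp add: c_def algebra_simps)
    also have "\<dots> \<le> norm y * (\<epsilon> / c) * c" using \<rho> c by (intro mult_right_mono) auto
    finally show "norm (P 0 k *v y) \<le> \<epsilon> * norm y" using c by (simp add: mult.commute)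
  qed
qed

text \<open>Moving the base time from 0 to \<open>n\<close> means applying first one matrix
  \<open>B\<close> that does not depend on \<open>k\<close>: \<open>P 0 n\<close>, or the inverse of
  \<open>P n 0\<close>. It carries the hyperplane of \<open>V n\<close> into that of
  \<open>v\<close>, and its operator bound is absorbed in \<open>\<epsilon>\<close>.\<close>

lemma past_contraction:
  assumes "\<epsilon> > 0"
  shows "eventually (\<lambda>k. \<forall>x. x \<bullet> V n = 0 \<longrightarrow> norm (P k n *v x) \<le> \<epsilon> * norm x) at_bot"
proof -
  have "\<exists>B. \<forall>x. (\<forall>k\<le>min n 0. P k n *v x = P k 0 *v (B *v x)) \<and> (B *v x) \<bullet> v = x \<bullet> V n"
  proof (cases "n \<ge> 0")
    case True
    then show ?thesis using inner_P_V[of 0 n]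
      by (intro exI[of _ "P 0 n"]) (simp add: P_mult_vec V_0)
  next
    case False
    have "P k n *v x = P k 0 *v (matrix_inv (P n 0) *v x)" if "k \<le> min n 0" for k x
      using that False P_mult_vec[of k n 0 "matrix_inv (P n 0) *v x"]
      by (simp add: mult_matrix_inv_vec[OF P_invertible])
    moreover have "(matrix_inv (P n 0) *v x) \<bullet> v = x \<bullet> V n" for x
      using False inner_P_V[of n 0 "matrix_inv (P n 0) *v x"]
      by (simp add: mult_matrix_inv_vec[OF P_invertible] V_0)
    ultimately show ?thesis by blast
  qed
  then obtain B where B: "\<And>k x. k \<le> min n 0 \<Longrightarrow> P k n *v x = P k 0 *v (B *v x)"
    "\<And>x. (B *v x) \<bullet> v = x \<bullet> V n" by blast
  obtain L where L: "L > 0" "\<And>x. norm (B *v x) \<le> L * norm x" using matrix_bound[of B] by blast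
  have "\<epsilon> / L > 0" using assms L(1) by simp
  from past_contraction_0[OF this] eventually_le_at_bot[of "min n 0"]
  show ?thesis
  proof eventually_elim
    case (elim k)
    show ?case
    proof (intro allI impI)
      fix x assume "x \<bullet> V n = 0"
      then have "norm (P k n *v x) \<le> \<epsilon> / L * norm (B *v x)" using elim B by simp
      also have "\<dots> \<le> \<epsilon> / L * (L * norm x)" using assms L by (intro mult_left_mono L) auto
      finally show "norm (P k n *v x) \<le> \<epsilon> * norm x" using L(1) by simp
    qed
  qed
qed

text \<open>The vectors range over the moving hyperplane at time \<open>k\<close>; read backwards,
  this is the expansion of the inverse products on the hyperplane at time \<open>n\<close>. The
  change of base time is now a fixed matrix \<open>C\<close> applied last.\<close>

lemma future_contraction:
  assumes "\<epsilon> > 0"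
  shows "eventually (\<lambda>k. \<forall>y. y \<bullet> V k = 0 \<longrightarrow> norm (P n k *v y) \<le> \<epsilon> * norm y) at_top"
proof -
  have "\<exists>C. \<forall>k\<ge>max n 0. \<forall>y. P n k *v y = C *v (P 0 k *v y)"
  proof (cases "n \<ge> 0")
    case True
    have "P n k *v y = matrix_inv (P 0 n) *v (P 0 k *v y)" if "k \<ge> max n 0" for k y
      using that True mult_matrix_inv_vec(2)[OF P_invertible, of 0 n "P n k *v y"]
      by (simp add: P_mult_vec)
    then show ?thesis by blast
  next
    case False
    then show ?thesis by (intro exI[of _ "P n 0"]) (simp add: P_mult_vec)
  qed
  then obtain C where C: "\<And>k y. k \<ge> max n 0 \<Longrightarrow> P n k *v y = C *v (P 0 k *v y)" by blast
  obtain L where L: "L > 0" "\<And>x. norm (C *v x) \<le> L * norm x" using matrix_bound[of C] by blast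
  have "\<epsilon> / L > 0" using assms L(1) by simp
  from future_contraction_0[OF this] eventually_ge_at_top[of "max n 0"]
  show ?thesis
  proof eventually_elim
    case (elim k)
    show ?case
    proof (intro allI impI)
      fix y assume "y \<bullet> V k = 0"
      then have "(P 0 k *v y) \<bullet> v = 0" using elim(2) inner_P_V[of 0 k y] by (simp add: V_0)
      then have "norm (P 0 k *v y) \<le> \<epsilon> / L * norm y" using elim(1) by blast
      then have "L * norm (P 0 k *v y) \<le> L * (\<epsilon> / L * norm y)" using L(1) by (intro mult_left_mono) auto
      with L(2)[of "P 0 k *v y"] show "norm (P n k *v y) \<le> \<epsilon> * norm y"
        using L(1) C[OF elim(2)] by simp
    qed
  qed
qed

text \<open>\<open>P 0 k *v U k\<close> is the fixed vector \<open>u\<close> while the column sums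
  of \<open>P 0 k\<close> diverge. As \<open>U k\<close> is nonnegative, nothing cancels and its
  coordinates must tend to 0.\<close>

lemma U_small_at_top:
  assumes "\<epsilon> > 0"
  shows "eventually (\<lambda>k. norm (U k) \<le> \<epsilon>) at_top"
proof -
  obtain j where j: "coord_sum u / \<epsilon> < 2 ^ j" using real_arch_pow[of 2] by auto
  have "\<exists>n>m. \<forall>i j. mprod M m n $ i $ j > 0" for m
    by (rule positive_product_of_primitive(1)[OF primitive])
  from column_sums_tend_to_infinity[OF two_le_card M this, of 0 j]
  obtain K where K: "K \<ge> 0" "\<And>k i. k \<ge> K \<Longrightarrow> coord_sum (P 0 k *v axis i 1) \<ge> 2 ^ j" by blast
  show ?thesis
    using eventually_ge_at_top[of K]
  proof eventually_elim
    case (elim k)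
    have "norm (U k) * 2 ^ j \<le> coord_sum (U k) * 2 ^ j"
      by (intro mult_right_mono norm_le_coord_sum U_nonneg) simp
    also have "\<dots> \<le> (\<Sum>i\<in>UNIV. U k $ i * coord_sum (P 0 k *v axis i 1))"
      unfolding coord_sum_def[of "U k"] sum_distrib_right
      by (intro sum_mono mult_left_mono K elim U_nonneg)
    also have "\<dots> = coord_sum (P 0 k *v U k)" by (subst (2) mult_vec_eq_sum_columns) simp
    also have "\<dots> = coord_sum u" using P_U[of 0 k] elim K(1) by (simp add: U_0)
    also have "\<dots> < \<epsilon> * 2 ^ j" using j assms by (simp add: field_simps)
    finally show ?case by simp
  qed
qed

text \<open>\<open>U k = P k 0 *v u\<close> dominates the row sums of \<open>P k 0\<close> times the
  smallest coordinate \<open>e\<close> of \<open>u\<close>. These row sums are column sums of the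
  reversed transposed products. The coordinate \<open>undefined\<close> stands for an arbitrary
  one.\<close>

lemma U_large_at_bot: "eventually (\<lambda>k. norm (U k) \<ge> B) at_bot"
proof -
  define e where "e = Min (range (($) u))"
  have e: "e > 0" "\<And>i. e \<le> u $ i" using u_pos by (auto simp: e_def)
  obtain j where j: "B / e < 2 ^ j" using real_arch_pow[of 2] by auto
  define M' where "M' n = transpose (M (- n - 1))" for n
  have M': "M' n \<in> nonneg_unimodular" for n
    by (simp add: M'_def nonneg_unimodular_transpose M)
  have P': "mprod M' m n = transpose (P (- n) (- m))" for m n
    using mprod_transpose_reversed[of M m n] by (simp add: M'_def[abs_def])
  have "\<exists>n>m. \<forall>i j. mprod M' m n $ i $ j > 0" for m
  proof -
    obtain n where "n < - m" "\<And>i j. P n (- m) $ i $ j > 0"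
      using positive_product_of_primitive(2)[OF primitive, of "- m"] by blast
    then show ?thesis by (intro exI[of _ "- n"]) (simp add: P' transpose_def)
  qed
  from column_sums_tend_to_infinity[OF two_le_card M' this, of 0 j]
  obtain K where K: "K \<ge> 0" "\<And>k i. k \<ge> K \<Longrightarrow> coord_sum (mprod M' 0 k *v axis i 1) \<ge> 2 ^ j"
    by blast
  show ?thesis
    using eventually_le_at_bot[of "- K"]
  proof eventually_elim
    case (elim k)
    have row: "(P k 0 *v ones) $ i \<ge> 2 ^ j" for i
    proof -
      have "coord_sum (transpose (P k 0) *v axis i 1) = (P k 0 *v ones) $ i"
        unfolding coord_sum_def mult_axis by (simp add: transpose_def matrix_vector_mult_def)
      then show ?thesis using K(2)[of "- k" i] elim by (simp add: P' del: transpose_matrix_vector)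
    qed
    have "B \<le> e * 2 ^ j" using j e(1) by (simp add: field_simps)
    also have "\<dots> \<le> e * (P k 0 *v ones) $ undefined" using row e(1) by (intro mult_left_mono) auto
    also have "\<dots> = (P k 0 *v (e *\<^sub>R ones)) $ undefined" by (simp add: matrix_vector_mult_scaleR)
    also have "\<dots> \<le> (P k 0 *v u) $ undefined"
      by (rule mult_vec_mono[OF P_nonneg]) (simp add: e(2))
    also have "\<dots> = U k $ undefined" using P_U[of k 0] elim K(1) by (simp add: U_0)
    also have "\<dots> \<le> norm (U k)" using component_le_norm_cart[of "U k" undefined] by simp
    finally show ?case .
  qed
qed

end

section \<open>From Euclidean estimates to suprema and infima in an arbitrary norm\<close>

lemma SUP_norm_ratio_tendsto_0:
  fixes f :: "'k \<Rightarrow> 'a::euclidean_space \<Rightarrow> 'a"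
  assumes N: "is_norm N"
    and small: "\<And>\<epsilon>. \<epsilon> > 0 \<Longrightarrow> eventually (\<lambda>k. \<forall>x\<in>G. norm (f k x) \<le> \<epsilon> * norm x) F"
  shows "((\<lambda>k. SUP x \<in> G - {0}. ennreal (N (f k x) / N x)) \<longlongrightarrow> 0) F"
proof (rule tendsto_zero_ennreal)
  fix r :: real assume r: "r > 0"
  obtain c C where c: "c > 0" and C: "C > 0" and lower: "\<And>x. c * norm x \<le> N x" and upper: "\<And>x. N x \<le> C * norm x"
    by (rule is_norm_equivalent[OF N]) (rule that)
  \<comment> \<open>Changing the norm costs at most the factor \<open>C / c\<close>, and the 2 keeps
    the supremum strictly below \<open>r\<close>.\<close>
  have "r / 2 * c / C > 0" using r c C by simp
  from small[OF this]
  show "eventually (\<lambda>k. (SUP x \<in> G - {0}. ennreal (N (f k x) / N x)) < ennreal r) F"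
  proof eventually_elim
    case (elim k)
    have "(SUP x \<in> G - {0}. ennreal (N (f k x) / N x)) \<le> ennreal (r / 2)"
    proof (intro SUP_least ennreal_leI)
      fix x assume x: "x \<in> G - {0}"
      then have Nx: "N x > 0" using lower[of x] c by (smt (verit) Diff_iff mult_pos_pos singletonI zero_less_norm_iff)
      have "N (f k x) \<le> C * norm (f k x)" by (rule upper)
      also have "\<dots> \<le> C * (r / 2 * c / C * norm x)" using elim x C by (intro mult_left_mono) auto
      also have "\<dots> = r / 2 * (c * norm x)" using C by simp
      also have "\<dots> \<le> r / 2 * N x" using r by (intro mult_left_mono lower) simp
      finally show "N (f k x) / N x \<le> r / 2" using Nx by (simp add: field_simps)
    qed
    also have "\<dots> < ennreal r" using r by (simp add: ennreal_less_iff)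
    finally show ?case .
  qed
qed

lemma INF_norm_ratio_tendsto_infinity:
  fixes f :: "'k \<Rightarrow> 'a::euclidean_space \<Rightarrow> 'a"
  assumes N: "is_norm N"
    and large: "\<And>B. B > 0 \<Longrightarrow> eventually (\<lambda>k. \<forall>x\<in>G. B * norm x \<le> norm (f k x)) F"
  shows "((\<lambda>k. INF x \<in> G - {0}. ennreal (N (f k x) / N x)) \<longlongrightarrow> \<infinity>) F"
  unfolding infinity_ennreal_def tendsto_top_iff_ennreal
proof (intro allI impI)
  fix l :: real assume l: "l \<ge> 0"
  obtain c C where c: "c > 0" and C: "C > 0" and lower: "\<And>x. c * norm x \<le> N x" and upper: "\<And>x. N x \<le> C * norm x"
    by (rule is_norm_equivalent[OF N]) (rule that)
  \<comment> \<open>The margin 1 keeps the infimum strictly above \<open>l\<close>; the factor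
    \<open>C / c\<close> pays for the change of norm.\<close>
  have "(l + 1) * C / c > 0" using l c C by simp
  from large[OF this]
  show "eventually (\<lambda>k. ennreal l < (INF x \<in> G - {0}. ennreal (N (f k x) / N x))) F"
  proof eventually_elim
    case (elim k)
    have "ennreal l < ennreal (l + 1)" using l by (simp add: ennreal_less_iff)
    also have "\<dots> \<le> (INF x \<in> G - {0}. ennreal (N (f k x) / N x))"
    proof (intro INF_greatest ennreal_leI)
      fix x assume x: "x \<in> G - {0}"
      then have Nx: "N x > 0" using lower[of x] c by (smt (verit) Diff_iff mult_pos_pos singletonI zero_less_norm_iff)
      have "(l + 1) * N x \<le> (l + 1) * (C * norm x)" using l by (intro mult_left_mono upper) simp
      also have "\<dots> = c * ((l + 1) * C / c * norm x)" using c by simp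
      also have "\<dots> \<le> c * norm (f k x)" using elim x c by (intro mult_left_mono) auto
      also have "\<dots> \<le> N (f k x)" by (rule lower)
      finally show "l + 1 \<le> N (f k x) / N x" using Nx by (simp add: field_simps)
    qed
    finally show ?case .
  qed
qed

context strongly_convergent
begin

lemma anosov:
  assumes N: "is_norm N"
  shows "eventually_anosov N (mapping_family M) (\<lambda>n. span {U n}) (\<lambda>n. orthogonal_comp {V n})"
  unfolding eventually_anosov_def
proof (intro exI[of _ M] conjI allI)
  show "induced_by (mapping_family M) M" by (rule mapping_family_lifts[OF M])
  show "invariant_splitting M (\<lambda>n. span {U n}) (\<lambda>n. orthogonal_comp {V n})" by (rule splitting)
  fix n
  have norm_U: "norm (U n) > 0" using U_nonzero by simp
  have Gu: "x \<in> orthogonal_comp {V n} \<longleftrightarrow> x \<bullet> V n = 0" for x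
    by (auto simp: orthogonal_comp_def orthogonal_def inner_commute)
  show "((\<lambda>k. SUP x \<in> span {U n} - {0}. ennreal (N (matrix_inv (P n k) *v x) / N x)) \<longlongrightarrow> 0) at_top"
  proof (rule SUP_norm_ratio_tendsto_0[OF N])
    fix \<epsilon> :: real assume "\<epsilon> > 0"
    then have "\<epsilon> * norm (U n) > 0" using norm_U by simp
    from U_small_at_top[OF this] eventually_ge_at_top[of n]
    show "eventually (\<lambda>k. \<forall>x\<in>span {U n}. norm (matrix_inv (P n k) *v x) \<le> \<epsilon> * norm x) at_top"
    proof eventually_elim
      case (elim k)
      have "matrix_inv (P n k) *v U n = U k"
        using mult_matrix_inv_vec(2)[OF P_invertible, of n k "U k"] P_U[OF elim(2)] by simp
      then have "norm (matrix_inv (P n k) *v (t *\<^sub>R U n)) = \<bar>t\<bar> * norm (U k)" for t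
        by (simp add: matrix_vector_mult_scaleR)
      moreover have "\<bar>t\<bar> * norm (U k) \<le> \<bar>t\<bar> * (\<epsilon> * norm (U n))" for t
        using elim(1) by (intro mult_left_mono) auto
      ultimately show ?case by (auto simp: span_singleton mult.left_commute)
    qed
  qed
  show "((\<lambda>k. INF x \<in> orthogonal_comp {V n} - {0}. ennreal (N (matrix_inv (P n k) *v x) / N x)) \<longlongrightarrow> \<infinity>) at_top"
  proof (rule INF_norm_ratio_tendsto_infinity[OF N])
    fix B :: real assume B: "B > 0"
    then have "1 / B > 0" by simp
    \<comment> \<open>Expansion of the inverse by \<open>B\<close> is contraction of
      \<open>P n k\<close> by \<open>1 / B\<close>, applied to the image \<open>y\<close> of
      \<open>x\<close>, which lies in the hyperplane at time \<open>k\<close>.\<close>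
    from future_contraction[OF this, of n] eventually_ge_at_top[of n]
    show "eventually (\<lambda>k. \<forall>x\<in>orthogonal_comp {V n}. B * norm x \<le> norm (matrix_inv (P n k) *v x)) at_top"
    proof eventually_elim
      case (elim k)
      show ?case
      proof
        fix x assume "x \<in> orthogonal_comp {V n}"
        moreover define y where "y = matrix_inv (P n k) *v x"
        have x: "P n k *v y = x" by (simp add: y_def mult_matrix_inv_vec[OF P_invertible])
        ultimately have "y \<bullet> V k = 0" using inner_P_V[OF elim(2), of y] by (simp add: Gu)
        then have "norm x \<le> 1 / B * norm y" using elim(1) x by blast
        then show "B * norm x \<le> norm (matrix_inv (P n k) *v x)"
          using B by (simp add: y_def field_simps)
      qed
    qed
  qed
  show "((\<lambda>k. INF x \<in> span {U n} - {0}. ennreal (N (P k n *v x) / N x)) \<longlongrightarrow> \<infinity>) at_bot"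
  proof (rule INF_norm_ratio_tendsto_infinity[OF N])
    fix B :: real
    from U_large_at_bot[of "B * norm (U n)"] eventually_le_at_bot[of n]
    show "eventually (\<lambda>k. \<forall>x\<in>span {U n}. B * norm x \<le> norm (P k n *v x)) at_bot"
    proof eventually_elim
      case (elim k)
      have "norm (P k n *v (t *\<^sub>R U n)) = \<bar>t\<bar> * norm (U k)" for t
        using P_U[OF elim(2)] by (simp add: matrix_vector_mult_scaleR)
      moreover have "\<bar>t\<bar> * (B * norm (U n)) \<le> \<bar>t\<bar> * norm (U k)" for t
        using elim(1) by (intro mult_left_mono) auto
      ultimately show ?case by (auto simp: span_singleton mult.left_commute)
    qed
  qed
  show "((\<lambda>k. SUP x \<in> orthogonal_comp {V n} - {0}. ennreal (N (P k n *v x) / N x)) \<longlongrightarrow> 0) at_bot"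
  proof (rule SUP_norm_ratio_tendsto_0[OF N])
    fix \<epsilon> :: real assume "\<epsilon> > 0"
    from past_contraction[OF this, of n]
    show "eventually (\<lambda>k. \<forall>x\<in>orthogonal_comp {V n}. norm (P k n *v x) \<le> \<epsilon> * norm x) at_bot"
      by eventually_elim (simp add: Gu)
  qed
qed

end

theorem theoremB:
  fixes M :: "int \<Rightarrow> real^'d^'d"
    and N :: "real^'d \<Rightarrow> real"
    and N' :: "real^'d^'d \<Rightarrow> real"
  assumes "CARD('d) \<ge> 2"
    and "is_norm N" and "is_norm N'"
    and "\<And>n. M n \<in> nonneg_unimodular"
    and "two_sided_primitive M"
    and "two_sided_local_pisot M"
    and "growth_condition N' M"
  shows "\<exists>u v.
     generalized_right_eigenvector M u \<and> strong_convergence_future M u \<and>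
     generalized_left_eigenvector M v \<and> strong_convergence_past M v \<and>
     eventually_anosov N (mapping_family M)
       (\<lambda>n. span {right_vec M u n}) (\<lambda>n. orthogonal_comp {left_vec M v n})"
proof -
  obtain u v where uv: "generalized_right_eigenvector M u" "strong_convergence_future M u"
    "generalized_left_eigenvector M v" "strong_convergence_past M v"
    using strong_convergence_future_and_past[OF assms(1,4,6,3,7)] by blast
  interpret strongly_convergent M u v
    by (rule strongly_convergent.intro[OF assms(1,4,5) uv])
  show ?thesis using uv anosov[OF assms(2)] by blast
qed

end
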